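(* Let $d_S$ be a Cayley metric on a finitely generated, infinite, virtually Abelian group $G$. Then $\partial_b(G,d_S)$ is finite if and only if $G$ is virtually-$\mathbb{Z}$.
   Context: A group is virtually Abelian (respectively virtually-$\mathbb{Z}$) if it has a finite index subgroup that is Abelian (respectively isomorphic to $\mathbb{Z}$). Cayley metric: for a finite symmetric generating set $S$ of $G$, the Cayley graph $\Gamma(G,S)$ has vertex set $G$ and edges $\{x,xs\}$ for $x\in G$, $s\in S$; $d_S$ is its graph metric. A Cayley metric is any metric of the form $d_S$ with $S$ a finite symmetric generating set. Busemann points: for $x\in G$ let $b_x\colon G\to\mathbb{R}$, $b_x(y)=d_S(x,y)-d_S(x,1)$. An infinite geodesic is a sequence $\gamma=(\gamma_n)_{n\ge 0}$ in $G$ with $d_S(\gamma_i,\gamma_j)=|i-j|$ for all $i,j\ge 0$. For such $\gamma$ the pointwise limit $\gamma_\infty=\lim_n b_{\gamma_n}$ exists. A Busemann point is a function of the form $\gamma_\infty$ for some infinite geodesic $\gamma$ (with arbitrary starting point), and $\partial_b(G,d_S)$ is the set of all Busemann points. *)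

theory Defs
  imports Complex_Main "HOL-Algebra.Algebra"
begin

definition virtually_abelian :: "('a, 'b) monoid_scheme \<Rightarrow> bool" where
  "virtually_abelian G \<longleftrightarrow>
    (\<exists>H. subgroup H G \<and> finite (rcosets\<^bsub>G\<^esub> H) \<and> comm_group (G\<lparr>carrier := H\<rparr>))"

definition virtually_int :: "('a, 'b) monoid_scheme \<Rightarrow> bool" where
  "virtually_int G \<longleftrightarrow>
    (\<exists>H. subgroup H G \<and> finite (rcosets\<^bsub>G\<^esub> H) \<and> G\<lparr>carrier := H\<rparr> \<cong> integer_group)"

definition finite_symmetric_generating_set :: "('a, 'b) monoid_scheme \<Rightarrow> 'a set \<Rightarrow> bool" where
  "finite_symmetric_generating_set G S \<longleftrightarrow>
    finite S \<and> S \<subseteq> carrier G \<and> (\<forall>s\<in>S. inv\<^bsub>G\<^esub> s \<in> S) \<and> generate G S = carrier G"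

text \<open>The identity is allowed in the generating set; it only contributes singleton edges (loops),
  which do not affect the graph metric.\<close>

definition cayley_edges :: "('a, 'b) monoid_scheme \<Rightarrow> 'a set \<Rightarrow> 'a set set" where
  "cayley_edges G S = {{x, x \<otimes>\<^bsub>G\<^esub> s} | x s. x \<in> carrier G \<and> s \<in> S}"

text \<open>A walk of length \<open>n\<close> is given by the first \<open>n + 1\<close> values of \<open>p\<close>; later values are irrelevant.\<close>

definition is_walk :: "'a set \<Rightarrow> 'a set set \<Rightarrow> nat \<Rightarrow> (nat \<Rightarrow> 'a) \<Rightarrow> bool" where
  "is_walk V E n p \<longleftrightarrow> (\<forall>i\<le>n. p i \<in> V) \<and> (\<forall>i<n. {p i, p (Suc i)} \<in> E)"

text \<open>Only meaningful when \<open>x\<close> and \<open>y\<close> are joined by a walk, which is always the case for vertices of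
  the Cayley graph of a generating set.\<close>

definition graph_dist :: "'a set \<Rightarrow> 'a set set \<Rightarrow> 'a \<Rightarrow> 'a \<Rightarrow> real" where
  "graph_dist V E x y = real (LEAST n. \<exists>p. is_walk V E n p \<and> p 0 = x \<and> p n = y)"

definition cayley_dist :: "('a, 'b) monoid_scheme \<Rightarrow> 'a set \<Rightarrow> 'a \<Rightarrow> 'a \<Rightarrow> real" where
  "cayley_dist G S = graph_dist (carrier G) (cayley_edges G S)"

definition infinite_geodesic ::
    "('a, 'b) monoid_scheme \<Rightarrow> ('a \<Rightarrow> 'a \<Rightarrow> real) \<Rightarrow> (nat \<Rightarrow> 'a) \<Rightarrow> bool" where
  "infinite_geodesic G d \<gamma> \<longleftrightarrow>
    (\<forall>i. \<gamma> i \<in> carrier G) \<and> (\<forall>i j. d (\<gamma> i) (\<gamma> j) = \<bar>real i - real j\<bar>)"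

definition busemann_fun ::
    "('a, 'b) monoid_scheme \<Rightarrow> ('a \<Rightarrow> 'a \<Rightarrow> real) \<Rightarrow> 'a \<Rightarrow> 'a \<Rightarrow> real" where
  "busemann_fun G d x y = d x y - d x \<one>\<^bsub>G\<^esub>"

text \<open>Functions on the group are represented extensionally, so that distinct elements of the set
  below differ at some element of \<open>carrier G\<close>.\<close>

definition busemann_points ::
    "('a, 'b) monoid_scheme \<Rightarrow> ('a \<Rightarrow> 'a \<Rightarrow> real) \<Rightarrow> ('a \<Rightarrow> real) set" where
  "busemann_points G d =
    {f \<in> extensional (carrier G).
      \<exists>\<gamma>. infinite_geodesic G d \<gamma> \<and>
          (\<forall>y\<in>carrier G. (\<lambda>n. busemann_fun G d (\<gamma> n) y) \<longlonglongrightarrow> f y)}"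

end

theory Submission
  imports Defs
begin

text \<open>
  If \<open>G\<close> is virtually \<open>\<int>\<close>, then \<open>G\<close> is coarsely a line, and every path from the far left to a point
  of a geodesic running to the right crosses a fixed translate of a finite set \<open>B\<close>. Hence a Busemann
  function of such a geodesic is determined on the left of the translate \<open>\<phi> n \<otimes> B\<close> by its
  increments on that translate. These are integers bounded independently of \<open>n\<close>, and every finite set
  of points lies to the left of some \<open>\<phi> n \<otimes> B\<close>, so each of the two ends carries boundedly many
  Busemann points.

  Conversely, let \<open>H\<close> be an abelian subgroup of finite index. Cutting loops out of paths in the coset
  graph shows that finitely many elements \<open>p c p\<inverse>\<close> of \<open>H\<close>, with \<open>c\<close> short, generate \<open>H\<close> and control every
  homomorphism \<open>g : H \<rightarrow> \<real>\<close> in terms of word length. If \<open>g \<noteq> 0\<close>, repeating a loop \<open>c\<close> that maximises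
  \<open>M = g (p c p\<inverse>) / |c|\<close> is a geodesic, and its Busemann function \<open>f\<close> satisfies \<open>g / M \<ge> - f - K\<close> on \<open>H\<close>.
  When there are only finitely many Busemann points, \<open>f\<close> is linear along suitable powers of each
  element, and so determines \<open>g / M\<close>. Up to positive scalars \<open>H\<close> then has only finitely many nonzero
  homomorphisms to \<open>\<real>\<close>, which excludes two independent ones; so \<open>H\<close> has rank one.
\<close>

section \<open>Homomorphisms from finitely generated abelian groups to the reals\<close>

text \<open>Additivity is demanded on \<open>A\<close> only and values elsewhere are arbitrary, so
  one type of function serves all subgroups and extending means agreeing on the smaller set.\<close>

definition real_hom :: "('a, 'b) monoid_scheme \<Rightarrow> 'a set \<Rightarrow> ('a \<Rightarrow> real) \<Rightarrow> bool" where
  "real_hom G A f \<longleftrightarrow> (\<forall>x\<in>A. \<forall>y\<in>A. f (x \<otimes>\<^bsub>G\<^esub> y) = f x + f y)"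

lemma real_hom_one:
  assumes "group G" "subgroup A G" "real_hom G A f"
  shows "f \<one>\<^bsub>G\<^esub> = 0"
proof -
  interpret group G by fact
  have "f (\<one>\<^bsub>G\<^esub> \<otimes>\<^bsub>G\<^esub> \<one>\<^bsub>G\<^esub>) = f \<one>\<^bsub>G\<^esub> + f \<one>\<^bsub>G\<^esub>"
    using assms(3) subgroup.one_closed[OF assms(2)] unfolding real_hom_def by blast
  then show ?thesis by simp
qed

lemma real_hom_inv:
  assumes "group G" "subgroup A G" "real_hom G A f" "x \<in> A"
  shows "f (inv\<^bsub>G\<^esub> x) = - f x"
proof -
  interpret group G by fact
  have "f (x \<otimes>\<^bsub>G\<^esub> inv\<^bsub>G\<^esub> x) = f x + f (inv\<^bsub>G\<^esub> x)"
    using assms(3,4) subgroup.m_inv_closed[OF assms(2)] unfolding real_hom_def by blast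
  moreover have "x \<in> carrier G" using assms(2,4) subgroup.mem_carrier by fastforce
  ultimately show ?thesis using real_hom_one[OF assms(1-3)] by simp
qed

lemma real_hom_nat_pow:
  assumes "group G" "subgroup A G" "real_hom G A f" "x \<in> A"
  shows "f (x [^]\<^bsub>G\<^esub> (n::nat)) = real n * f x"
proof -
  interpret group G by fact
  have mem: "x [^]\<^bsub>G\<^esub> k \<in> A" for k :: nat
    by (induction k) (use assms(2,4) in \<open>auto simp: subgroup.one_closed subgroup.m_closed\<close>)
  show ?thesis
  proof (induction n)
    case (Suc n)
    have "f (x [^]\<^bsub>G\<^esub> n \<otimes>\<^bsub>G\<^esub> x) = f (x [^]\<^bsub>G\<^esub> n) + f x"
      using assms(3,4) mem unfolding real_hom_def by blast
    with Suc show ?case by (simp add: algebra_simps)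
  qed (simp add: real_hom_one[OF assms(1-3)])
qed

lemma real_hom_int_pow:
  assumes "group G" "subgroup A G" "real_hom G A f" "x \<in> A"
  shows "f (x [^]\<^bsub>G\<^esub> (n::int)) = real_of_int n * f x"
proof -
  interpret group G by fact
  have x: "x \<in> carrier G" using assms(2,4) subgroup.mem_carrier by fastforce
  have mem: "x [^]\<^bsub>G\<^esub> k \<in> A" for k :: nat
    by (induction k) (use assms(2,4) in \<open>auto simp: subgroup.one_closed subgroup.m_closed\<close>)
  show ?thesis
  proof (cases n)
    case (nonneg k)
    then show ?thesis using real_hom_nat_pow[OF assms] by (simp add: int_pow_int)
  next
    case (neg k)
    then show ?thesis
      using real_hom_nat_pow[OF assms, of "Suc k"] real_hom_inv[OF assms(1-3) mem[of "Suc k"]] x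
      by (simp add: int_pow_neg_int del: nat_pow_Suc of_nat_Suc)
  qed
qed

section \<open>Adjoining generators one at a time in an abelian group\<close>

text \<open>In a commutative group, for a subgroup \<open>A\<close>, this is the subgroup generated
  by \<open>A\<close> and \<open>g\<close>; the explicit form lets a homomorphism be prescribed by
  its values on \<open>A\<close> and at \<open>g\<close>.\<close>

definition (in group) adjoin :: "'a set \<Rightarrow> 'a \<Rightarrow> 'a set" where
  "adjoin A g = {a \<otimes> g [^] (n::int) | a n. a \<in> A}"

context comm_group
begin

lemma adjoin_mult:
  assumes "subgroup A G" "g \<in> carrier G" "a \<in> A" "b \<in> A"
  shows "(a \<otimes> g [^] (m::int)) \<otimes> (b \<otimes> g [^] (n::int)) = (a \<otimes> b) \<otimes> g [^] (m + n)"
proof -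
  have "a \<in> carrier G" "b \<in> carrier G" using assms subgroup.mem_carrier by fastforce+
  then show ?thesis using assms(2) by (simp add: int_pow_mult m_ac)
qed

lemma adjoin_subgroup:
  assumes A: "subgroup A G" and g: "g \<in> carrier G"
  shows "subgroup (adjoin A g) G"
proof (rule subgroupI)
  have c: "a \<in> carrier G" if "a \<in> A" for a using A that subgroup.mem_carrier by fastforce
  show "adjoin A g \<subseteq> carrier G" using c g by (auto simp: adjoin_def)
  show "adjoin A g \<noteq> {}" using subgroup.one_closed[OF A] by (auto simp: adjoin_def)
  fix x assume "x \<in> adjoin A g"
  then obtain a and n :: int where x: "a \<in> A" "x = a \<otimes> g [^] n" by (auto simp: adjoin_def)
  have "inv x = inv a \<otimes> g [^] (-n)"
    using x c g by (simp add: inv_mult int_pow_neg)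
  then show "inv x \<in> adjoin A g"
    using subgroup.m_inv_closed[OF A x(1)] by (auto simp: adjoin_def)
  fix y assume "y \<in> adjoin A g"
  then obtain b and m :: int where y: "b \<in> A" "y = b \<otimes> g [^] m" by (auto simp: adjoin_def)
  show "x \<otimes> y \<in> adjoin A g"
    using adjoin_mult[OF A g x(1) y(1)] subgroup.m_closed[OF A x(1) y(1)]
    unfolding x y adjoin_def by blast
qed

lemma adjoin_superset:
  assumes "subgroup A G" "g \<in> carrier G"
  shows "A \<subseteq> adjoin A g" "g \<in> adjoin A g"
proof -
  show "A \<subseteq> adjoin A g"
  proof
    fix a assume "a \<in> A"
    moreover have "a = a \<otimes> g [^] (0::int)" using calculation assms(1) subgroup.mem_carrier by fastforce
    ultimately show "a \<in> adjoin A g" unfolding adjoin_def by blast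
  qed
  have "g = \<one> \<otimes> g [^] (1::int)" using assms(2) by simp
  then show "g \<in> adjoin A g"
    using subgroup.one_closed[OF assms(1)] unfolding adjoin_def by blast
qed

text \<open>Once all of the finite set \<open>E\<close> has been adjoined to \<open>T\<close>, the
  subgroup reached contains generators of the group. Extensions of homomorphisms and finite coset
  covers are both built this way.\<close>

lemma adjoin_induct:
  assumes E: "finite E" "E \<subseteq> carrier G" and gen: "generate G E = carrier G"
    and T: "subgroup T G" "P T"
    and step: "\<And>A g. \<lbrakk>subgroup A G; T \<subseteq> A; P A; g \<in> E\<rbrakk> \<Longrightarrow> P (adjoin A g)"
  shows "P (carrier G)"
proof -
  have "\<exists>A. subgroup A G \<and> T \<subseteq> A \<and> Y \<subseteq> A \<and> P A" if "finite Y" "Y \<subseteq> E" for Y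
    using that
  proof (induction Y rule: finite_induct)
    case empty
    then show ?case using T by blast
  next
    case (insert g Y)
    then obtain A where A: "subgroup A G" "T \<subseteq> A" "Y \<subseteq> A" "P A" by auto
    have g: "g \<in> carrier G" "g \<in> E" using insert.prems E by auto
    show ?case
      using adjoin_subgroup[OF A(1) g(1)] adjoin_superset[OF A(1) g(1)] step[OF A(1,2,4) g(2)] A
      by (intro exI[of _ "adjoin A g"]) auto
  qed
  then obtain A where A: "subgroup A G" "E \<subseteq> A" "P A" using E by blast
  have "generate G E \<subseteq> A" using generate_subgroup_incl[OF A(2,1)] .
  moreover have "A \<subseteq> carrier G" using A(1) by (rule subgroup.subset)
  ultimately show ?thesis using A(3) gen by auto
qed

text \<open>The premise on \<open>r\<close> is the compatibility needed: two expressions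
  \<open>a \<otimes> g [^] n\<close> of one element differ by a power of \<open>g\<close> that lies
  in \<open>A\<close>.\<close>

lemma real_hom_extend_adjoin:
  assumes A: "subgroup A G" and g: "g \<in> carrier G" and f: "real_hom G A f"
    and r: "\<And>n::int. g [^] n \<in> A \<Longrightarrow> f (g [^] n) = real_of_int n * r"
  shows "\<exists>f'. real_hom G (adjoin A g) f' \<and>
           (\<forall>a\<in>A. \<forall>n::int. f' (a \<otimes> g [^] n) = f a + real_of_int n * r)"
proof -
  have c: "a \<in> carrier G" if "a \<in> A" for a using A that subgroup.mem_carrier by fastforce
  \<comment> \<open>An arbitrary expression of \<open>x\<close> is chosen; \<open>val\<close> then
    shows that the value does not depend on it.\<close>
  define f' where "f' x = (SOME v. \<exists>a\<in>A. \<exists>n::int. x = a \<otimes> g [^] n \<and> v = f a + real_of_int n * r)" for x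
  have val: "f' (a \<otimes> g [^] n) = f a + real_of_int n * r" if a: "a \<in> A" for a and n :: int
  proof -
    have "\<exists>b\<in>A. \<exists>m::int. a \<otimes> g [^] n = b \<otimes> g [^] m \<and> f' (a \<otimes> g [^] n) = f b + real_of_int m * r"
      unfolding f'_def by (rule someI_ex) (use a in blast)
    then obtain b and m :: int where b: "b \<in> A" "a \<otimes> g [^] n = b \<otimes> g [^] m"
      "f' (a \<otimes> g [^] n) = f b + real_of_int m * r" by blast
    have ca: "a \<in> carrier G" and cb: "b \<in> carrier G" using c a b by auto
    have "g [^] (n - m) = inv a \<otimes> (a \<otimes> g [^] n) \<otimes> inv (g [^] m)"
      using ca g by (simp add: int_pow_diff m_assoc[symmetric])
    also have "\<dots> = inv a \<otimes> b"
      unfolding b(2) using ca cb g by (simp add: m_assoc)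
    finally have eq: "g [^] (n - m) = inv a \<otimes> b" .
    have ia: "inv a \<in> A" using a subgroup.m_inv_closed[OF A] by blast
    have "f (inv a \<otimes> b) = f b - f a"
      using f ia b(1) real_hom_inv[OF is_group A f a] unfolding real_hom_def by auto
    moreover have "f (inv a \<otimes> b) = real_of_int (n - m) * r"
      using r[of "n - m"] eq subgroup.m_closed[OF A ia b(1)] by simp
    ultimately show ?thesis using b(3) by (simp add: algebra_simps)
  qed
  have "real_hom G (adjoin A g) f'"
    unfolding real_hom_def
  proof (intro ballI)
    fix x y assume "x \<in> adjoin A g" "y \<in> adjoin A g"
    then obtain a b and m n :: int where xy: "a \<in> A" "b \<in> A" "x = a \<otimes> g [^] m" "y = b \<otimes> g [^] n"
      by (auto simp: adjoin_def)
    have "x \<otimes> y = (a \<otimes> b) \<otimes> g [^] (m + n)" using adjoin_mult[OF A g] xy by simp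
    moreover have "f (a \<otimes> b) = f a + f b" using f xy unfolding real_hom_def by auto
    ultimately show "f' (x \<otimes> y) = f' x + f' y"
      using val xy subgroup.m_closed[OF A] by (simp add: algebra_simps)
  qed
  then show ?thesis using val by blast
qed

text \<open>The reals are divisible: if a nonzero power \<open>g [^] m\<close> already lies in
  \<open>A\<close>, the value at \<open>g\<close> is forced to be that of the power divided by
  \<open>m\<close>, consistently for all such \<open>m\<close>.\<close>

lemma real_hom_extend:
  assumes E: "finite E" "E \<subseteq> carrier G" and gen: "generate G E = carrier G"
    and T: "subgroup T G" and f: "real_hom G T f"
  shows "\<exists>f'. real_hom G (carrier G) f' \<and> (\<forall>x\<in>T. f' x = f x)"
proof (rule adjoin_induct[OF E gen T])
  show "\<exists>f'. real_hom G T f' \<and> (\<forall>x\<in>T. f' x = f x)" using f by blast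
next
  fix A g assume A: "subgroup A G" "T \<subseteq> A" and g: "g \<in> E"
    and "\<exists>f'. real_hom G A f' \<and> (\<forall>x\<in>T. f' x = f x)"
  then obtain h where h: "real_hom G A h" "\<And>x. x \<in> T \<Longrightarrow> h x = f x" by blast
  have gc: "g \<in> carrier G" using g E by blast
  have "\<exists>r. \<forall>n::int. g [^] n \<in> A \<longrightarrow> h (g [^] n) = real_of_int n * r"
  proof (cases "\<exists>m::int. m \<noteq> 0 \<and> g [^] m \<in> A")
    case True
    then obtain m :: int where m: "m \<noteq> 0" "g [^] m \<in> A" by blast
    have "h (g [^] n) = real_of_int n * (h (g [^] m) / real_of_int m)" if n: "g [^] n \<in> A" for n :: int
    proof -
      have "(g [^] n) [^] m = (g [^] m) [^] n" using gc by (simp add: int_pow_pow mult.commute)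
      then have "real_of_int m * h (g [^] n) = real_of_int n * h (g [^] m)"
        using real_hom_int_pow[OF is_group A(1) h(1) n, of m]
          real_hom_int_pow[OF is_group A(1) h(1) m(2), of n] by simp
      then show ?thesis using m(1) by (simp add: field_simps)
    qed
    then show ?thesis by blast
  next
    case False
    \<comment> \<open>Here only \<open>n = 0\<close> gives a power in \<open>A\<close>, so every
      \<open>r\<close> is admissible and \<open>0\<close> is taken.\<close>
    then show ?thesis using real_hom_one[OF is_group A(1) h(1)] by (intro exI[of _ 0]) (auto, metis int_pow_0)
  qed
  then obtain r where r: "\<And>n::int. g [^] n \<in> A \<Longrightarrow> h (g [^] n) = real_of_int n * r" by blast
  obtain f' where f': "real_hom G (adjoin A g) f'"
    "\<And>a (n::int). a \<in> A \<Longrightarrow> f' (a \<otimes> g [^] n) = h a + real_of_int n * r"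
    using real_hom_extend_adjoin[OF A(1) gc h(1) r] by auto
  have "f' x = f x" if "x \<in> T" for x
  proof -
    have "x \<in> A" using that A by blast
    moreover have "x \<in> carrier G" using calculation A(1) subgroup.mem_carrier by fastforce
    ultimately show ?thesis using f'(2)[of x 0] h(2)[OF that] by simp
  qed
  with f'(1) show "\<exists>f'. real_hom G (adjoin A g) f' \<and> (\<forall>x\<in>T. f' x = f x)" by blast
qed

text \<open>The quotient by \<open>T\<close> is a finitely generated abelian torsion group, hence
  finite. In terms of representatives, adjoining \<open>g\<close> with
  \<open>g [^] n \<in> T\<close> costs at most a factor \<open>n\<close>.\<close>

lemma finite_cosets_of_torsion_quotient:
  assumes E: "finite E" "E \<subseteq> carrier G" and gen: "generate G E = carrier G"
    and T: "subgroup T G" and tor: "\<And>x. x \<in> E \<Longrightarrow> \<exists>n::nat. n > 0 \<and> x [^] n \<in> T"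
  shows "\<exists>F. finite F \<and> F \<subseteq> carrier G \<and> carrier G \<subseteq> (\<Union>q\<in>F. T #> q)"
proof (rule adjoin_induct[OF E gen T,
      where P = "\<lambda>A. \<exists>F. finite F \<and> F \<subseteq> carrier G \<and> A \<subseteq> (\<Union>q\<in>F. T #> q)"])
  show "\<exists>F. finite F \<and> F \<subseteq> carrier G \<and> T \<subseteq> (\<Union>q\<in>F. T #> q)"
    using coset_mult_one[OF subgroup.subset[OF T]] by (intro exI[of _ "{\<one>}"]) auto
next
  fix A g assume A: "subgroup A G" "T \<subseteq> A" and g: "g \<in> E"
    and "\<exists>F. finite F \<and> F \<subseteq> carrier G \<and> A \<subseteq> (\<Union>q\<in>F. T #> q)"
  then obtain F where F: "finite F" "F \<subseteq> carrier G" "A \<subseteq> (\<Union>q\<in>F. T #> q)" by blast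
  have gc: "g \<in> carrier G" using g E by blast
  obtain n :: nat where n: "n > 0" "g [^] n \<in> T" using tor[OF g] by blast
  define F' where "F' = (\<lambda>(q, k::nat). q \<otimes> g [^] k) ` (F \<times> {..<n})"
  have "adjoin A g \<subseteq> (\<Union>q\<in>F'. T #> q)"
  proof
    fix x assume "x \<in> adjoin A g"
    then obtain a and m :: int where x: "a \<in> A" "x = a \<otimes> g [^] m" by (auto simp: adjoin_def)
    have ac: "a \<in> carrier G" using x A subgroup.mem_carrier by fastforce
    \<comment> \<open>Division with remainder: the part of \<open>g [^] m\<close> whose exponent is
      a multiple of \<open>n\<close> lies in \<open>T\<close> and is absorbed by \<open>A\<close>;
      only \<open>g [^] k\<close> with \<open>k < n\<close> remains.\<close>
    define k where "k = nat (m mod int n)"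
    have k: "k < n" "m = int n * (m div int n) + int k" using n(1) by (auto simp: k_def nat_less_iff)
    have "g [^] m = g [^] (int n * (m div int n)) \<otimes> g [^] (int k)"
      using k(2) gc int_pow_mult by metis
    also have "g [^] (int n * (m div int n)) = (g [^] n) [^] (m div int n)"
      using gc by (simp add: int_pow_pow[symmetric] int_pow_int)
    finally have gm: "g [^] m = (g [^] n) [^] (m div int n) \<otimes> g [^] k" by (simp add: int_pow_int)
    define u where "u = (g [^] n) [^] (m div int n)"
    have u: "u \<in> T" unfolding u_def using subgroup_int_pow_closed[OF T n(2)] .
    have uc: "u \<in> carrier G" using u T subgroup.mem_carrier by fastforce
    have "a \<otimes> u \<in> A" using x(1) u A subgroup.m_closed by fastforce
    then obtain q where q: "q \<in> F" "a \<otimes> u \<in> T #> q" using F by blast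
    then obtain t where t: "t \<in> T" "a \<otimes> u = t \<otimes> q" by (auto simp: r_coset_def)
    have tc: "t \<in> carrier G" "q \<in> carrier G" using t T subgroup.mem_carrier q F by fastforce+
    have "x = (a \<otimes> u) \<otimes> g [^] k" unfolding x gm u_def[symmetric] using ac uc gc by (simp add: m_assoc)
    also have "\<dots> = t \<otimes> (q \<otimes> g [^] k)" unfolding t(2) using tc gc by (simp add: m_assoc)
    finally have "x \<in> T #> (q \<otimes> g [^] k)" using t(1) by (auto simp: r_coset_def)
    moreover have "q \<otimes> g [^] k \<in> F'" using q(1) k(1) by (auto simp: F'_def)
    ultimately show "x \<in> (\<Union>q\<in>F'. T #> q)" by blast
  qed
  moreover have "finite F'" "F' \<subseteq> carrier G" using F gc by (auto simp: F'_def)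
  ultimately show "\<exists>F. finite F \<and> F \<subseteq> carrier G \<and> adjoin A g \<subseteq> (\<Union>q\<in>F. T #> q)" by blast
qed

end

section \<open>Word metrics\<close>

text \<open>The geometric arguments see the Cayley graph only through these properties. Path steps
  are merely \<open>\<le> 1\<close>, so a path may rest after reaching its end.\<close>

locale word_metric = group G for G :: "('a, 'b) monoid_scheme" (structure) +
  fixes d :: "'a \<Rightarrow> 'a \<Rightarrow> nat"
  assumes d_eq_0: "\<lbrakk>x \<in> carrier G; y \<in> carrier G\<rbrakk> \<Longrightarrow> d x y = 0 \<longleftrightarrow> x = y"
    and d_sym: "\<lbrakk>x \<in> carrier G; y \<in> carrier G\<rbrakk> \<Longrightarrow> d x y = d y x"
    and d_triangle: "\<lbrakk>x \<in> carrier G; y \<in> carrier G; z \<in> carrier G\<rbrakk> \<Longrightarrow> d x z \<le> d x y + d y z"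
    and d_left: "\<lbrakk>g \<in> carrier G; x \<in> carrier G; y \<in> carrier G\<rbrakk> \<Longrightarrow> d (g \<otimes> x) (g \<otimes> y) = d x y"
    and finite_ball: "finite {y \<in> carrier G. d \<one> y \<le> n}"
    and geodesic_path: "\<lbrakk>x \<in> carrier G; y \<in> carrier G\<rbrakk> \<Longrightarrow>
      \<exists>w. w 0 = x \<and> w (d x y) = y \<and> (\<forall>i. w i \<in> carrier G) \<and> (\<forall>i. d (w i) (w (Suc i)) \<le> 1)"

section \<open>Walks in the Cayley graph\<close>

lemma is_walk_append:
  assumes p: "is_walk V E m p" "p 0 = x" "p m = y" and q: "is_walk V E n q" "q 0 = y" "q n = z"
  shows "\<exists>r. is_walk V E (m + n) r \<and> r 0 = x \<and> r (m + n) = z"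
proof -
  define r where "r i = (if i \<le> m then p i else q (i - m))" for i
  have "is_walk V E (m + n) r"
    unfolding is_walk_def
  proof (intro conjI allI impI)
    fix i assume "i \<le> m + n"
    then show "r i \<in> V" using p(1) q(1) by (auto simp: r_def is_walk_def)
  next
    fix i assume i: "i < m + n"
    consider "i < m" | "i = m" | "i > m" by linarith
    then show "{r i, r (Suc i)} \<in> E"
    proof cases
      case 2
      then show ?thesis using p(3) q i by (auto simp: r_def is_walk_def)
    next
      case 3
      then have "{q (i - m), q (Suc (i - m))} \<in> E" using q(1) i by (auto simp: is_walk_def)
      then show ?thesis using 3 by (simp add: r_def Suc_diff_le)
    qed (use p(1) in \<open>auto simp: r_def is_walk_def\<close>)
  qed
  moreover have "r 0 = x" "r (m + n) = z" using p q by (cases n; simp add: r_def)+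
  ultimately show ?thesis by blast
qed

lemma is_walk_rev:
  assumes "is_walk V E n p"
  shows "is_walk V E n (\<lambda>i. p (n - i))"
  unfolding is_walk_def
proof (intro conjI allI impI)
  fix i assume "i < n"
  then have "{p (n - Suc i), p (Suc (n - Suc i))} \<in> E" using assms by (simp add: is_walk_def)
  then show "{p (n - i), p (n - Suc i)} \<in> E" using \<open>i < n\<close> by (simp add: Suc_diff_Suc insert_commute)
qed (use assms in \<open>auto simp: is_walk_def\<close>)

locale cayley = group G for G :: "('a, 'b) monoid_scheme" (structure) +
  fixes S :: "'a set"
  assumes gens: "finite_symmetric_generating_set G S"
begin

abbreviation "walk \<equiv> is_walk (carrier G) (cayley_edges G S)"

definition word_dist :: "'a \<Rightarrow> 'a \<Rightarrow> nat" where
  "word_dist x y = (LEAST n. \<exists>p. walk n p \<and> p 0 = x \<and> p n = y)"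

lemma S_closed: "s \<in> S \<Longrightarrow> s \<in> carrier G"
  using gens by (auto simp: finite_symmetric_generating_set_def)

lemma edge_mult: "\<lbrakk>x \<in> carrier G; s \<in> S\<rbrakk> \<Longrightarrow> {x, x \<otimes> s} \<in> cayley_edges G S"
  by (auto simp: cayley_edges_def)

text \<open>An unordered edge may have been written from either endpoint; closure of
  \<open>S\<close> under inverses lets it be read from \<open>x\<close>.\<close>

lemma edgeE:
  assumes "{x, y} \<in> cayley_edges G S"
  shows "\<exists>s\<in>S. y = x \<otimes> s"
proof -
  obtain z s where z: "{x, y} = {z, z \<otimes> s}" "z \<in> carrier G" "s \<in> S"
    using assms by (auto simp: cayley_edges_def)
  have "inv s \<in> S" using z(3) gens by (auto simp: finite_symmetric_generating_set_def)
  moreover have "z = z \<otimes> s \<otimes> inv s" using z S_closed by (simp add: m_assoc)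
  ultimately show ?thesis using z(1,3) by (auto simp: doubleton_eq_iff)
qed

lemma walk_left_mult:
  assumes "g \<in> carrier G" "walk n p"
  shows "walk n (\<lambda>i. g \<otimes> p i)"
  unfolding is_walk_def
proof (intro conjI allI impI)
  fix i assume "i < n"
  then have "{p i, p (Suc i)} \<in> cayley_edges G S" "p i \<in> carrier G"
    using assms(2) by (auto simp: is_walk_def)
  moreover obtain s where "s \<in> S" "p (Suc i) = p i \<otimes> s" using edgeE calculation by blast
  ultimately show "{g \<otimes> p i, g \<otimes> p (Suc i)} \<in> cayley_edges G S"
    using edge_mult[of "g \<otimes> p i" s] assms(1) S_closed by (simp add: m_assoc)
qed (use assms in \<open>auto simp: is_walk_def\<close>)

text \<open>Induction over generation: for a product \<open>h1 \<otimes> h2\<close> the walk to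
  \<open>h2\<close> is translated by \<open>h1\<close> and appended to the walk to
  \<open>h1\<close>.\<close>

lemma walk_from_one:
  assumes "x \<in> carrier G"
  shows "\<exists>n p. walk n p \<and> p 0 = \<one> \<and> p n = x"
proof -
  have one_step: "\<exists>n p. walk n p \<and> p 0 = \<one> \<and> p n = s" if "s \<in> S" for s
    using edge_mult[of \<one> s] that S_closed[OF that]
    by (intro exI[of _ 1] exI[of _ "\<lambda>i. if i = 0 then \<one> else s"]) (auto simp: is_walk_def)
  have "x \<in> generate G S" using assms gens by (simp add: finite_symmetric_generating_set_def)
  then show ?thesis
  proof (induction rule: generate.induct)
    case one
    show ?case by (intro exI[of _ 0] exI[of _ "\<lambda>_. \<one>"]) (auto simp: is_walk_def)
  next
    case (inv h)
    then show ?case using one_step[of "inv h"] gens by (auto simp: finite_symmetric_generating_set_def)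
  next
    case (eng h1 h2)
    then obtain m p n q where p: "walk m p" "p 0 = \<one>" "p m = h1" and q: "walk n q" "q 0 = \<one>" "q n = h2"
      by blast
    have "h1 \<in> carrier G" using p by (auto simp: is_walk_def)
    then have "walk n (\<lambda>i. h1 \<otimes> q i)" "h1 \<otimes> q 0 = h1" using walk_left_mult q by auto
    then have "\<exists>r. walk (m + n) r \<and> r 0 = \<one> \<and> r (m + n) = h1 \<otimes> h2"
      using is_walk_append[OF p, of n "\<lambda>i. h1 \<otimes> q i"] q(3) by simp
    then show ?case by blast
  qed (use one_step in auto)
qed

lemma walk_exists:
  assumes "x \<in> carrier G" "y \<in> carrier G"
  shows "\<exists>n p. walk n p \<and> p 0 = x \<and> p n = y"
proof -
  obtain n p where p: "walk n p" "p 0 = \<one>" "p n = inv x \<otimes> y"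
    using walk_from_one[of "inv x \<otimes> y"] assms by auto
  have "x \<otimes> (inv x \<otimes> y) = y" using assms by (simp add: m_assoc[symmetric])
  then show ?thesis
    using walk_left_mult[OF assms(1) p(1)] p assms
    by (intro exI[of _ n] exI[of _ "\<lambda>i. x \<otimes> p i"]) auto
qed

lemma word_dist_walk:
  assumes "x \<in> carrier G" "y \<in> carrier G"
  shows "\<exists>p. walk (word_dist x y) p \<and> p 0 = x \<and> p (word_dist x y) = y"
  unfolding word_dist_def by (rule LeastI_ex[OF walk_exists[OF assms]])

lemma word_dist_le: "\<lbrakk>walk n p; p 0 = x; p n = y\<rbrakk> \<Longrightarrow> word_dist x y \<le> n"
  unfolding word_dist_def by (rule Least_le) blast

lemma finite_walk_ends: "finite {y. \<exists>p. walk n p \<and> p 0 = \<one> \<and> p n = y}"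
proof (induction n)
  case 0
  have "{y. \<exists>p. walk 0 p \<and> p 0 = \<one> \<and> p 0 = y} \<subseteq> {\<one>}" by auto
  then show ?case using finite_subset by blast
next
  case (Suc n)
  let ?B = "\<lambda>n. {y. \<exists>p. walk n p \<and> p 0 = \<one> \<and> p n = y}"
  have "?B (Suc n) \<subseteq> (\<lambda>(x, s). x \<otimes> s) ` (?B n \<times> S)"
  proof
    fix y assume "y \<in> ?B (Suc n)"
    then obtain p where p: "walk (Suc n) p" "p 0 = \<one>" "p (Suc n) = y" by blast
    have "walk n p" using p(1) by (auto simp: is_walk_def)
    moreover obtain s where "s \<in> S" "y = p n \<otimes> s"
      using p edgeE[of "p n" y] by (auto simp: is_walk_def)
    ultimately show "y \<in> (\<lambda>(x, s). x \<otimes> s) ` (?B n \<times> S)" using p(2) by force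
  qed
  moreover have "finite S" using gens by (simp add: finite_symmetric_generating_set_def)
  ultimately show ?case using Suc finite_subset by blast
qed

lemma word_dist_left_le:
  assumes "g \<in> carrier G" "x \<in> carrier G" "y \<in> carrier G"
  shows "word_dist (g \<otimes> x) (g \<otimes> y) \<le> word_dist x y"
proof -
  obtain p where p: "walk (word_dist x y) p" "p 0 = x" "p (word_dist x y) = y"
    using word_dist_walk[OF assms(2,3)] by blast
  show ?thesis
    by (rule word_dist_le[OF walk_left_mult[OF assms(1) p(1)]]) (simp_all add: p)
qed

sublocale word_metric G word_dist
proof unfold_locales
  fix x y assume xy: "x \<in> carrier G" "y \<in> carrier G"
  show "word_dist x y = 0 \<longleftrightarrow> x = y"
  proof
    show "x = y" if "word_dist x y = 0" using word_dist_walk[OF xy] that by auto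
    show "word_dist x y = 0" if "x = y"
      using word_dist_le[of 0 "\<lambda>_. x" x y] xy that by (auto simp: is_walk_def)
  qed
  have le: "word_dist y x \<le> word_dist x y" if xy: "x \<in> carrier G" "y \<in> carrier G" for x y
  proof -
    obtain p where "walk (word_dist x y) p" "p 0 = x" "p (word_dist x y) = y"
      using word_dist_walk[OF xy] by blast
    then show ?thesis using word_dist_le[OF is_walk_rev] by auto
  qed
  show "word_dist x y = word_dist y x" using le xy by (simp add: antisym)
  show "word_dist x z \<le> word_dist x y + word_dist y z" if "z \<in> carrier G" for z
  proof -
    obtain p q where p: "walk (word_dist x y) p" "p 0 = x" "p (word_dist x y) = y"
      and q: "walk (word_dist y z) q" "q 0 = y" "q (word_dist y z) = z"
      using word_dist_walk[OF xy] word_dist_walk[OF xy(2) \<open>z \<in> carrier G\<close>] by blast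
    show ?thesis using is_walk_append[OF p q] word_dist_le by blast
  qed
  show "word_dist (g \<otimes> x) (g \<otimes> y) = word_dist x y" if g: "g \<in> carrier G" for g
  proof (rule antisym)
    show "word_dist x y \<le> word_dist (g \<otimes> x) (g \<otimes> y)"
      using word_dist_left_le[of "inv g" "g \<otimes> x" "g \<otimes> y"] g xy by (simp add: m_assoc[symmetric])
  qed (use word_dist_left_le g xy in auto)
  show "\<exists>w. w 0 = x \<and> w (word_dist x y) = y \<and> (\<forall>i. w i \<in> carrier G) \<and>
      (\<forall>i. word_dist (w i) (w (Suc i)) \<le> 1)"
  proof -
    define n where "n = word_dist x y"
    obtain p where p: "walk n p" "p 0 = x" "p n = y"
      using word_dist_walk[OF xy] n_def by blast
    \<comment> \<open>The walk is frozen at its last vertex from index \<open>n\<close> on, which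
      makes the step bound hold at every index.\<close>
    have "word_dist (p (min n i)) (p (min n (Suc i))) \<le> 1" for i
    proof (cases "i < n")
      case True
      then have "walk 1 (\<lambda>j. p (i + j))" using p(1) by (auto simp: is_walk_def)
      then show ?thesis using True word_dist_le[of 1 "\<lambda>j. p (i + j)"] by auto
    next
      case False
      have "p n \<in> carrier G" using p(1) by (auto simp: is_walk_def)
      then have "walk 0 (\<lambda>_. p n)" by (auto simp: is_walk_def)
      then have "word_dist (p n) (p n) \<le> 0" using word_dist_le by blast
      then show ?thesis using False by (simp add: min_def)
    qed
    moreover have "p (min n i) \<in> carrier G" for i using p(1) by (auto simp: is_walk_def)
    ultimately show ?thesis
      using p unfolding n_def[symmetric] by (intro exI[of _ "\<lambda>i. p (min n i)"]) auto
  qed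
next
  fix n
  have "{y \<in> carrier G. word_dist \<one> y \<le> n} \<subseteq> (\<Union>k\<le>n. {y. \<exists>p. walk k p \<and> p 0 = \<one> \<and> p k = y})"
    using word_dist_walk[OF one_closed] by blast
  then show "finite {y \<in> carrier G. word_dist \<one> y \<le> n}"
    using finite_walk_ends finite_subset by blast
qed

lemma cayley_dist_eq: "cayley_dist G S = (\<lambda>x y. real (word_dist x y))"
  by (intro ext) (simp add: cayley_dist_def graph_dist_def word_dist_def)

end

section \<open>Busemann functions\<close>

text \<open>Integers closer than 1 coincide, so convergence of distance differences is eventual
  equality.\<close>

lemma Ints_tendsto_imp_eventually_eq:
  fixes u :: "nat \<Rightarrow> real"
  assumes u: "\<And>n. u n \<in> \<int>" and lim: "u \<longlonglongrightarrow> l"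
  shows "\<forall>\<^sub>F n in sequentially. u n = l"
proof -
  have "\<forall>\<^sub>F n in sequentially. dist (u n) l < 1/2" using lim by (rule tendstoD) simp
  then obtain N where N: "\<And>n. n \<ge> N \<Longrightarrow> \<bar>u n - l\<bar> < 1/2"
    by (auto simp: eventually_sequentially dist_real_def)
  have "u n = u N" if "n \<ge> N" for n
  proof -
    have "\<bar>u n - u N\<bar> < 1" using N[of n] N[of N] that by linarith
    moreover have "u n - u N \<in> \<int>" using u by (intro Ints_diff)
    ultimately show ?thesis using Ints_nonzero_abs_less1 by fastforce
  qed
  then have ev: "\<forall>\<^sub>F n in sequentially. u n = u N" unfolding eventually_sequentially by blast
  then have "u \<longlonglongrightarrow> u N" by (rule tendsto_eventually)
  then have "l = u N" using lim LIMSEQ_unique by blast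
  with ev show ?thesis by simp
qed

lemma decseq_nat_eventually_const:
  fixes u :: "nat \<Rightarrow> nat"
  assumes "decseq u"
  shows "\<exists>c. \<forall>\<^sub>F n in sequentially. u n = c"
proof -
  obtain N where N: "\<And>n. u N \<le> u n" using ex_has_least_nat[of "\<lambda>_. True" 0 u] by blast
  have "u n = u N" if "n \<ge> N" for n using N[of n] decseqD[OF assms that] by simp
  then show ?thesis unfolding eventually_sequentially by blast
qed

context word_metric
begin

abbreviation "geodesic \<equiv> infinite_geodesic G (\<lambda>x y. real (d x y))"

abbreviation "busemann \<equiv> busemann_points G (\<lambda>x y. real (d x y))"

text \<open>Eventual equality stands in for pointwise convergence; \<open>busemann_iff\<close> shows
  that nothing changes, because the distances are integers.\<close>

definition limit_of :: "(nat \<Rightarrow> 'a) \<Rightarrow> ('a \<Rightarrow> real) \<Rightarrow> bool" where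
  "limit_of \<gamma> f \<longleftrightarrow>
    (\<forall>y\<in>carrier G. \<forall>\<^sub>F n in sequentially. real (d (\<gamma> n) y) - real (d (\<gamma> n) \<one>) = f y)"

lemma d_self: "x \<in> carrier G \<Longrightarrow> d x x = 0"
  by (simp add: d_eq_0)

lemma geodesic_closed: "geodesic \<gamma> \<Longrightarrow> \<gamma> i \<in> carrier G"
  by (simp add: infinite_geodesic_def)

lemma geodesic_dist: "\<lbrakk>geodesic \<gamma>; i \<le> j\<rbrakk> \<Longrightarrow> d (\<gamma> i) (\<gamma> j) = j - i"
proof -
  assume "geodesic \<gamma>" and ij: "i \<le> j"
  then have "real (d (\<gamma> i) (\<gamma> j)) = \<bar>real i - real j\<bar>" by (simp add: infinite_geodesic_def)
  then have "real (d (\<gamma> i) (\<gamma> j)) = real (j - i)" using ij by (simp add: of_nat_diff)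
  then show ?thesis by simp
qed

lemma busemann_iff: "f \<in> busemann \<longleftrightarrow> f \<in> extensional (carrier G) \<and> (\<exists>\<gamma>. geodesic \<gamma> \<and> limit_of \<gamma> f)"
proof -
  have eq: "(\<lambda>n. real (d (\<gamma> n) y) - real (d (\<gamma> n) \<one>)) \<longlonglongrightarrow> f y \<longleftrightarrow>
      (\<forall>\<^sub>F n in sequentially. real (d (\<gamma> n) y) - real (d (\<gamma> n) \<one>) = f y)" for \<gamma> y
  proof
    assume lim: "(\<lambda>n. real (d (\<gamma> n) y) - real (d (\<gamma> n) \<one>)) \<longlonglongrightarrow> f y"
    show "\<forall>\<^sub>F n in sequentially. real (d (\<gamma> n) y) - real (d (\<gamma> n) \<one>) = f y"
      by (rule Ints_tendsto_imp_eventually_eq[OF _ lim]) (intro Ints_diff Ints_of_nat)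
  qed (rule tendsto_eventually)
  have lim: "(\<forall>y\<in>carrier G. (\<lambda>n. real (d (\<gamma> n) y) - real (d (\<gamma> n) \<one>)) \<longlonglongrightarrow> f y) \<longleftrightarrow> limit_of \<gamma> f" for \<gamma>
    unfolding limit_of_def by (intro ball_cong refl eq)
  show ?thesis
    unfolding busemann_points_def busemann_fun_def mem_Collect_eq lim ..
qed

lemma limit_of_exists:
  assumes \<gamma>: "geodesic \<gamma>"
  shows "\<exists>f\<in>busemann. limit_of \<gamma> f"
proof -
  have c: "\<gamma> i \<in> carrier G" for i using geodesic_closed[OF \<gamma>] .
  have ex: "\<exists>e::real. \<forall>\<^sub>F n in sequentially. real (d (\<gamma> n) y) - real n = e" if y: "y \<in> carrier G" for y
  proof -
    \<comment> \<open>Adding the constant \<open>d (\<gamma> 0) y\<close> keeps the natural-number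
      subtraction exact, by \<open>ge\<close>. The sequence decreases, since one step along
      \<open>\<gamma>\<close> changes the distance to \<open>y\<close> by at most 1.\<close>
    define u where "u n = d (\<gamma> n) y + d (\<gamma> 0) y - n" for n
    have ge: "n \<le> d (\<gamma> n) y + d (\<gamma> 0) y" for n
      using d_triangle[OF c[of 0] y c[of n]] geodesic_dist[OF \<gamma>, of 0 n] d_sym[OF y c[of n]] by simp
    have "decseq u"
    proof (rule decseq_SucI)
      fix n
      have "d (\<gamma> (Suc n)) y \<le> 1 + d (\<gamma> n) y"
        using d_triangle[OF c[of "Suc n"] c[of n] y] geodesic_dist[OF \<gamma>, of n "Suc n"]
          d_sym[OF c[of n] c[of "Suc n"]] by simp
      then show "u (Suc n) \<le> u n" by (simp add: u_def)
    qed
    then obtain k where "\<forall>\<^sub>F n in sequentially. u n = k" using decseq_nat_eventually_const by blast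
    then have "\<forall>\<^sub>F n in sequentially. real (d (\<gamma> n) y) - real n = real k - real (d (\<gamma> 0) y)"
    proof eventually_elim
      case (elim n)
      then show ?case using ge[of n] by (simp add: u_def)
    qed
    then show ?thesis by blast
  qed
  then obtain e :: "'a \<Rightarrow> real" where e: "\<And>y. y \<in> carrier G \<Longrightarrow> \<forall>\<^sub>F n in sequentially. real (d (\<gamma> n) y) - real n = e y"
    by metis
  define f where "f = restrict (\<lambda>y. e y - e \<one>) (carrier G)"
  have "limit_of \<gamma> f"
    unfolding limit_of_def
  proof
    fix y assume y: "y \<in> carrier G"
    show "\<forall>\<^sub>F n in sequentially. real (d (\<gamma> n) y) - real (d (\<gamma> n) \<one>) = f y"
      using e[OF y] e[OF one_closed] by eventually_elim (simp add: f_def y)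
  qed
  moreover have "f \<in> extensional (carrier G)" by (simp add: f_def)
  ultimately show ?thesis using \<gamma> busemann_iff by blast
qed

lemma path_dist_le:
  assumes c: "\<And>i. w i \<in> carrier G" and step: "\<And>i. d (w i) (w (Suc i)) \<le> 1"
  shows "d (w i) (w (i + k)) \<le> k"
proof (induction k)
  case (Suc k)
  then show ?case using d_triangle[OF c[of i] c[of "i + k"] c[of "i + Suc k"]] step[of "i + k"] by simp
qed (simp add: d_self c)

text \<open>A shortcut between two indices would shorten every longer initial segment, so it
  suffices that arbitrarily long initial segments have full length.\<close>

lemma geodesicI:
  assumes c: "\<And>i. \<gamma> i \<in> carrier G" and step: "\<And>i. d (\<gamma> i) (\<gamma> (Suc i)) \<le> 1"
    and far: "\<And>m. \<exists>n\<ge>m. n \<le> d (\<gamma> 0) (\<gamma> n)"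
  shows "geodesic \<gamma>"
proof -
  note le = path_dist_le[of \<gamma>, OF c step]
  have eq: "d (\<gamma> i) (\<gamma> j) = j - i" if "i \<le> j" for i j
  proof (rule antisym)
    show "d (\<gamma> i) (\<gamma> j) \<le> j - i" using le[of i "j - i"] that by simp
    obtain n where n: "n \<ge> j" "n \<le> d (\<gamma> 0) (\<gamma> n)" using far by blast
    show "j - i \<le> d (\<gamma> i) (\<gamma> j)"
      using n d_triangle[OF c[of 0] c[of i] c[of n]] d_triangle[OF c[of i] c[of j] c[of n]]
        le[of 0 i] le[of j "n - j"] that by simp
  qed
  have "real (d (\<gamma> i) (\<gamma> j)) = \<bar>real i - real j\<bar>" for i j
    using eq[of i j] eq[of j i] d_sym[OF c[of i] c[of j]] by (cases "i \<le> j") (simp_all add: of_nat_diff)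
  then show ?thesis using c by (simp add: infinite_geodesic_def)
qed

lemma busemann_one: "f \<in> busemann \<Longrightarrow> f \<one> = 0"
proof -
  assume "f \<in> busemann"
  then obtain \<gamma> where "limit_of \<gamma> f" unfolding busemann_iff by blast
  then have "\<forall>\<^sub>F n in sequentially. real (d (\<gamma> n) \<one>) - real (d (\<gamma> n) \<one>) = f \<one>"
    unfolding limit_of_def using one_closed by (rule bspec)
  then obtain n where "real (d (\<gamma> n) \<one>) - real (d (\<gamma> n) \<one>) = f \<one>"
    unfolding eventually_sequentially by blast
  then show ?thesis by linarith
qed

lemma busemann_Ints:
  assumes "f \<in> busemann" "x \<in> carrier G"
  shows "f x \<in> \<int>"
proof -
  obtain \<gamma> where "limit_of \<gamma> f" using assms(1) by (auto simp: busemann_iff)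
  then have "\<forall>\<^sub>F n in sequentially. real (d (\<gamma> n) x) - real (d (\<gamma> n) \<one>) = f x"
    using assms(2) by (simp add: limit_of_def)
  then have "\<forall>\<^sub>F n in sequentially. f x \<in> \<int>"
    by eventually_elim (metis Ints_diff Ints_of_nat)
  then show ?thesis by simp
qed

lemma busemann_lipschitz:
  assumes "f \<in> busemann" "x \<in> carrier G" "y \<in> carrier G"
  shows "f x \<le> f y + real (d x y)"
proof -
  obtain \<gamma> where \<gamma>: "geodesic \<gamma>" "limit_of \<gamma> f" using assms(1) by (auto simp: busemann_iff)
  have "\<forall>\<^sub>F n in sequentially. real (d (\<gamma> n) x) - real (d (\<gamma> n) \<one>) = f x"
    "\<forall>\<^sub>F n in sequentially. real (d (\<gamma> n) y) - real (d (\<gamma> n) \<one>) = f y"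
    using \<gamma>(2) assms by (auto simp: limit_of_def)
  then have "\<forall>\<^sub>F n in sequentially. f x \<le> f y + real (d x y)"
  proof eventually_elim
    case (elim n)
    have "d (\<gamma> n) x \<le> d (\<gamma> n) y + d x y"
      using d_triangle[OF geodesic_closed[OF \<gamma>(1)] assms(3,2)] d_sym[OF assms(2,3)] by simp
    then show ?case using elim by linarith
  qed
  then show ?thesis by simp
qed

text \<open>Translating the geodesic by \<open>inv g\<close> gives a geodesic; subtracting
  \<open>f g\<close> restores the value 0 at \<open>\<one>\<close>.\<close>

lemma busemann_translate:
  assumes f: "f \<in> busemann" and g: "g \<in> carrier G"
  shows "restrict (\<lambda>y. f (g \<otimes> y) - f g) (carrier G) \<in> busemann"
proof -
  obtain \<gamma> where \<gamma>: "geodesic \<gamma>" "limit_of \<gamma> f" using f by (auto simp: busemann_iff)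
  note c = geodesic_closed[OF \<gamma>(1)]
  let ?\<gamma> = "\<lambda>i. inv g \<otimes> \<gamma> i"
  have "geodesic ?\<gamma>"
    using \<gamma>(1) c g by (auto simp: infinite_geodesic_def d_left)
  moreover have "limit_of ?\<gamma> (restrict (\<lambda>y. f (g \<otimes> y) - f g) (carrier G))"
    unfolding limit_of_def
  proof
    fix y assume y: "y \<in> carrier G"
    have shift: "d (inv g \<otimes> \<gamma> n) z = d (\<gamma> n) (g \<otimes> z)" if "z \<in> carrier G" for n z
    proof -
      have "g \<otimes> (inv g \<otimes> \<gamma> n) = \<gamma> n" using c g by (simp add: m_assoc[symmetric])
      then show ?thesis using d_left[OF g _ that, of "inv g \<otimes> \<gamma> n"] c g by simp
    qed
    have "\<forall>\<^sub>F n in sequentially. real (d (\<gamma> n) (g \<otimes> y)) - real (d (\<gamma> n) \<one>) = f (g \<otimes> y)"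
      "\<forall>\<^sub>F n in sequentially. real (d (\<gamma> n) g) - real (d (\<gamma> n) \<one>) = f g"
      using \<gamma>(2) g y by (auto simp: limit_of_def)
    then show "\<forall>\<^sub>F n in sequentially. real (d (?\<gamma> n) y) - real (d (?\<gamma> n) \<one>) =
        restrict (\<lambda>y. f (g \<otimes> y) - f g) (carrier G) y"
      by eventually_elim (simp add: shift y g)
  qed
  ultimately show ?thesis by (auto simp: busemann_iff)
qed

end

section \<open>Virtually cyclic groups\<close>

lemma (in group) coset_representatives:
  assumes H: "subgroup H G" and fin: "finite (rcosets H)"
  obtains q where "finite (q ` carrier G)" "\<And>x. x \<in> carrier G \<Longrightarrow> q x \<in> carrier G"
    "\<And>x. x \<in> carrier G \<Longrightarrow> \<exists>h\<in>H. x = h \<otimes> q x"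
    "\<And>h x. \<lbrakk>h \<in> H; x \<in> carrier G\<rbrakk> \<Longrightarrow> q (h \<otimes> x) = q x"
proof
  \<comment> \<open>The choice depends on the coset alone, which yields both the finite image and
    the invariance under \<open>H\<close>.\<close>
  define q where "q x = (SOME r. r \<in> H #> x)" for x
  have q: "q x \<in> H #> x" if "x \<in> carrier G" for x
    unfolding q_def using rcos_self[OF that H] by (rule someI)
  show "q x \<in> carrier G" if "x \<in> carrier G" for x
    using q[OF that] r_coset_subset_G[OF subgroup.subset[OF H] that] by blast
  have "q ` carrier G \<subseteq> (\<lambda>C. SOME r. r \<in> C) ` (rcosets H)"
    using rcosetsI[OF subgroup.subset[OF H]] by (auto simp: q_def)
  then show "finite (q ` carrier G)" using fin finite_surj by blast
  show "\<exists>h\<in>H. x = h \<otimes> q x" if x: "x \<in> carrier G" for x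
  proof -
    have "H #> x = H #> q x" using repr_independence[OF q[OF x] x H] .
    then have "x \<in> H #> q x" using rcos_self[OF x H] by simp
    then show ?thesis by (auto simp: r_coset_def)
  qed
  show "q (h \<otimes> x) = q x" if h: "h \<in> H" and x: "x \<in> carrier G" for h x
  proof -
    have hc: "h \<in> carrier G" using h subgroup.subset[OF H] by blast
    have "H #> (h \<otimes> x) = H #> x"
      using coset_mult_assoc[OF subgroup.subset[OF H] hc x] coset_join2[OF hc H h] by simp
    then show ?thesis by (simp add: q_def)
  qed
qed

section \<open>Busemann points at one end of a line-like group\<close>

context word_metric
begin

text \<open>A discrete intermediate value argument: take the first vertex of a geodesic with height
  at least \<open>n\<close>. Its predecessor is below \<open>n\<close>, so it overshoots by at most
  \<open>D\<close>.\<close>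

lemma geodesic_crossing:
  fixes \<pi> :: "'a \<Rightarrow> int"
  assumes step: "\<And>x y. \<lbrakk>x \<in> carrier G; y \<in> carrier G; d x y \<le> 1\<rbrakk> \<Longrightarrow> \<pi> y \<le> \<pi> x + D"
    and x: "x \<in> carrier G" "\<pi> x < n" and y: "y \<in> carrier G" "n \<le> \<pi> y"
  shows "\<exists>z\<in>carrier G. n \<le> \<pi> z \<and> \<pi> z \<le> n + D \<and> d x y = d x z + d z y"
proof -
  obtain w where w: "w 0 = x" "w (d x y) = y" and c: "\<And>i. w i \<in> carrier G"
    and s: "\<And>i. d (w i) (w (Suc i)) \<le> 1"
    using geodesic_path[OF x(1) y(1)] by blast
  define i where "i = (LEAST i. n \<le> \<pi> (w i))"
  have i: "n \<le> \<pi> (w i)" "i \<le> d x y"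
    using LeastI[of "\<lambda>i. n \<le> \<pi> (w i)" "d x y"] Least_le[of "\<lambda>i. n \<le> \<pi> (w i)" "d x y"] w(2) y(2)
    by (simp_all add: i_def)
  have "i \<noteq> 0" using i(1) w x by (intro notI) simp
  then obtain k where k: "i = Suc k" using not0_implies_Suc by blast
  have "\<not> n \<le> \<pi> (w k)" by (rule not_less_Least) (simp add: i_def[symmetric] k)
  then have "\<pi> (w i) \<le> n + D" using step[OF c[of k] c[of i]] s[of k] k by simp
  moreover have "d x y = d x (w i) + d (w i) y"
    using path_dist_le[of w, OF c s, of 0 i] path_dist_le[of w, OF c s, of i "d x y - i"] w i(2)
      d_triangle[OF x(1) c[of i] y(1)] by simp
  ultimately show ?thesis using i c by blast
qed

text \<open>Replacing \<open>\<pi>\<close> by \<open>- \<pi>\<close> gives the opposite end, so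
  finiteness has to be shown only once.\<close>

definition busemann_end :: "('a \<Rightarrow> int) \<Rightarrow> ('a \<Rightarrow> real) set" where
  "busemann_end \<pi> = {f \<in> busemann. \<exists>\<gamma>. geodesic \<gamma> \<and> limit_of \<gamma> f \<and> (\<forall>m. \<exists>i. m \<le> \<pi> (\<gamma> i))}"

text \<open>\<open>\<pi>\<close> is a height that changes by at most \<open>D\<close> along an edge,
  and every slab of thickness \<open>D\<close> lies in a translate by some \<open>\<phi> n\<close>
  of one finite set \<open>B\<close>.\<close>

context
  fixes \<pi> :: "'a \<Rightarrow> int" and \<phi> :: "int \<Rightarrow> 'a" and B :: "'a set" and D :: int
  assumes step: "\<And>x y. \<lbrakk>x \<in> carrier G; y \<in> carrier G; d x y \<le> 1\<rbrakk> \<Longrightarrow> \<pi> y \<le> \<pi> x + D"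
    and \<phi>: "\<And>n. \<phi> n \<in> carrier G"
    and B: "finite B" "B \<subseteq> carrier G"
    and strip: "\<And>x n. \<lbrakk>x \<in> carrier G; n \<le> \<pi> x; \<pi> x \<le> n + D\<rbrakk> \<Longrightarrow> \<exists>z\<in>B. x = \<phi> n \<otimes> z"
begin

text \<open>A geodesic from \<open>y\<close> to a far point of \<open>\<gamma>\<close> crosses the
  strip. As the strip is finite, one index serves all its points at once and the additivity of
  distances passes to the limit.\<close>

lemma busemann_end_cut:
  assumes f: "f \<in> busemann_end \<pi>" and y: "y \<in> carrier G" "\<pi> y < n"
  shows "\<exists>z\<in>B. f y = real (d y (\<phi> n \<otimes> z)) + f (\<phi> n \<otimes> z)"
proof -
  obtain \<gamma> where \<gamma>: "geodesic \<gamma>" "limit_of \<gamma> f" and unb: "\<And>m. \<exists>i. m \<le> \<pi> (\<gamma> i)"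
    using f by (auto simp: busemann_end_def)
  note c = geodesic_closed[OF \<gamma>(1)]
  define Z where "Z = insert y ((\<lambda>z. \<phi> n \<otimes> z) ` B)"
  have Z: "finite Z" "Z \<subseteq> carrier G" using B \<phi> y by (auto simp: Z_def)
  have "\<forall>\<^sub>F i in sequentially. \<forall>z\<in>Z. real (d (\<gamma> i) z) - real (d (\<gamma> i) \<one>) = f z"
    using \<gamma>(2) Z by (intro eventually_ball_finite) (auto simp: limit_of_def)
  then obtain N where N: "\<And>i z. \<lbrakk>i \<ge> N; z \<in> Z\<rbrakk> \<Longrightarrow> real (d (\<gamma> i) z) - real (d (\<gamma> i) \<one>) = f z"
    unfolding eventually_sequentially by blast
  obtain i where i: "i \<ge> N" "n \<le> \<pi> (\<gamma> i)"
  proof -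
    \<comment> \<open>\<open>m\<close> exceeds every height up to index \<open>N\<close>, so a
      vertex of height at least \<open>m\<close> occurs only after \<open>N\<close>.\<close>
    define m where "m = Max (insert n ((\<lambda>i. \<pi> (\<gamma> i)) ` {..N})) + 1"
    have fin: "finite (insert n ((\<lambda>i. \<pi> (\<gamma> i)) ` {..N}))" by simp
    have m: "n < m" "\<And>i. i \<le> N \<Longrightarrow> \<pi> (\<gamma> i) < m"
      unfolding m_def zle_add1_eq_le by (rule Max_ge[OF fin], simp)+
    obtain i where "m \<le> \<pi> (\<gamma> i)" using unb by blast
    with m(1) m(2)[of i] that[of i] show thesis by (cases "i \<le> N") auto
  qed
  obtain z where z: "z \<in> carrier G" "n \<le> \<pi> z" "\<pi> z \<le> n + D"
    "d y (\<gamma> i) = d y z + d z (\<gamma> i)"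
    using geodesic_crossing[OF step y c i(2)] by auto
  obtain b where b: "b \<in> B" "z = \<phi> n \<otimes> b" using strip[OF z(1-3)] by blast
  have "y \<in> Z" "z \<in> Z" using b by (auto simp: Z_def)
  then have "real (d (\<gamma> i) y) - real (d (\<gamma> i) \<one>) = f y" "real (d (\<gamma> i) z) - real (d (\<gamma> i) \<one>) = f z"
    using N i(1) by auto
  moreover have "d (\<gamma> i) y = d y z + d (\<gamma> i) z" using z(1,4) d_sym c y(1) by simp
  ultimately have "f y = real (d y z) + f z" by simp
  then show ?thesis using b by blast
qed

text \<open>With the Lipschitz bound, the cut makes \<open>f\<close> on the left a minimum over the
  strip of distance plus value, so strip increments fix \<open>f\<close> up to a constant. Since
  \<open>\<one>\<close> lies on the left, that constant is fixed too.\<close>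

lemma busemann_end_eqI:
  assumes f: "f \<in> busemann_end \<pi>" and g: "g \<in> busemann_end \<pi>"
    and eq: "\<And>z. z \<in> B \<Longrightarrow> f (\<phi> n \<otimes> z) - f (\<phi> n) = g (\<phi> n \<otimes> z) - g (\<phi> n)"
    and one: "\<pi> \<one> < n" and y: "y \<in> carrier G" "\<pi> y < n"
  shows "f y = g y"
proof -
  have le: "f' x - f' (\<phi> n) \<le> g' x - g' (\<phi> n)"
    if f': "f' \<in> busemann_end \<pi>" and g': "g' \<in> busemann_end \<pi>" and x: "x \<in> carrier G" "\<pi> x < n"
      and eq': "\<And>z. z \<in> B \<Longrightarrow> f' (\<phi> n \<otimes> z) - f' (\<phi> n) = g' (\<phi> n \<otimes> z) - g' (\<phi> n)" for f' g' x
  proof -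
    obtain z where z: "z \<in> B" "g' x = real (d x (\<phi> n \<otimes> z)) + g' (\<phi> n \<otimes> z)"
      using busemann_end_cut[OF g' x] by blast
    have "\<phi> n \<otimes> z \<in> carrier G" using \<phi> B z by auto
    then have "f' x \<le> f' (\<phi> n \<otimes> z) + real (d x (\<phi> n \<otimes> z))"
      using busemann_lipschitz[of f' x "\<phi> n \<otimes> z"] f' x by (simp add: busemann_end_def)
    then show ?thesis using z(2) eq'[OF z(1)] by linarith
  qed
  have "f x - f (\<phi> n) = g x - g (\<phi> n)" if "x \<in> carrier G" "\<pi> x < n" for x
    using le[OF f g that eq] le[OF g f that eq[symmetric]] by linarith
  from this[OF one_closed one] this[OF y] show ?thesis
    using f g by (simp add: busemann_end_def busemann_one)
qed

text \<open>Finitely many distinct points are separated at finitely many places. With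
  \<open>n\<close> beyond all of these, the increments on the strip already tell the points
  apart.\<close>

lemma finite_busemann_end: "finite (busemann_end \<pi>)"
proof (rule ccontr)
  assume inf: "infinite (busemann_end \<pi>)"
  \<comment> \<open>The possible increments: integers bounded by the Lipschitz property. Left
    invariance makes this set independent of \<open>n\<close>, which is chosen only later.\<close>
  define V where "V = PiE B (\<lambda>z. real_of_int ` {- int (d \<one> z)..int (d \<one> z)})"
  have V: "finite V" unfolding V_def using B by (intro finite_PiE) auto
  obtain P where P: "P \<subseteq> busemann_end \<pi>" "finite P" "card P = Suc (card V)"
    using infinite_arbitrarily_large[OF inf] by blast
  have "\<exists>y\<in>carrier G. f y \<noteq> g y" if "f \<in> P" "g \<in> P" "f \<noteq> g" for f g
  proof (rule ccontr)
    have "f \<in> extensional (carrier G)" "g \<in> extensional (carrier G)"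
      using that P(1) by (auto simp: busemann_end_def busemann_iff)
    moreover assume "\<not> (\<exists>y\<in>carrier G. f y \<noteq> g y)"
    ultimately show False using that(3) extensionalityI by metis
  qed
  then obtain \<delta> where \<delta>: "\<And>f g. \<lbrakk>f \<in> P; g \<in> P; f \<noteq> g\<rbrakk> \<Longrightarrow> \<delta> f g \<in> carrier G \<and> f (\<delta> f g) \<noteq> g (\<delta> f g)"
    by metis
  define n where "n = Max (insert (\<pi> \<one>) ((\<lambda>(f, g). \<pi> (\<delta> f g)) ` (P \<times> P))) + 1"
  have fin: "finite (insert (\<pi> \<one>) ((\<lambda>(f, g). \<pi> (\<delta> f g)) ` (P \<times> P)))" using P(2) by simp
  have n: "\<pi> \<one> < n" "\<And>f g. \<lbrakk>f \<in> P; g \<in> P\<rbrakk> \<Longrightarrow> \<pi> (\<delta> f g) < n"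
    unfolding n_def zle_add1_eq_le by (rule Max_ge[OF fin], force)+
  define code where "code f = restrict (\<lambda>z. f (\<phi> n \<otimes> z) - f (\<phi> n)) B" for f :: "'a \<Rightarrow> real"
  have "inj_on code P"
  proof (rule inj_onI, rule ccontr)
    fix f g assume fg: "f \<in> P" "g \<in> P" "code f = code g" "f \<noteq> g"
    have "f (\<phi> n \<otimes> z) - f (\<phi> n) = g (\<phi> n \<otimes> z) - g (\<phi> n)" if "z \<in> B" for z
      using fun_cong[OF fg(3), of z] that by (simp add: code_def)
    then have "f (\<delta> f g) = g (\<delta> f g)"
      using busemann_end_eqI[of f g n "\<delta> f g"] n fg \<delta> P(1) by blast
    then show False using \<delta> fg by blast
  qed
  moreover have "code ` P \<subseteq> V"
  proof
    fix c assume "c \<in> code ` P"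
    then obtain f where f: "f \<in> P" "c = code f" by blast
    then have fb: "f \<in> busemann" using P(1) by (auto simp: busemann_end_def)
    have "f (\<phi> n \<otimes> z) - f (\<phi> n) \<in> real_of_int ` {- int (d \<one> z)..int (d \<one> z)}" if z: "z \<in> B" for z
    proof -
      have zc: "z \<in> carrier G" using z B by blast
      have dz: "d (\<phi> n) (\<phi> n \<otimes> z) = d \<one> z" "d (\<phi> n \<otimes> z) (\<phi> n) = d \<one> z"
        using d_left[OF \<phi>[of n] one_closed zc] d_sym \<phi> zc by auto
      have "f (\<phi> n \<otimes> z) - f (\<phi> n) \<in> \<int>" using busemann_Ints[OF fb] \<phi> zc by (intro Ints_diff) auto
      then obtain k where k: "f (\<phi> n \<otimes> z) - f (\<phi> n) = real_of_int k" by (auto elim: Ints_cases)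
      have "f (\<phi> n \<otimes> z) \<le> f (\<phi> n) + real (d \<one> z)" "f (\<phi> n) \<le> f (\<phi> n \<otimes> z) + real (d \<one> z)"
        using busemann_lipschitz[OF fb, of "\<phi> n \<otimes> z" "\<phi> n"] busemann_lipschitz[OF fb, of "\<phi> n" "\<phi> n \<otimes> z"]
          \<phi> zc dz by auto
      then have "k \<in> {- int (d \<one> z)..int (d \<one> z)}" using k by auto
      then show ?thesis using k by blast
    qed
    then show "c \<in> V" unfolding f(2) code_def V_def by auto
  qed
  ultimately have "card P \<le> card V" using V card_inj_on_le by blast
  then show False using P(3) by simp
qed

end

text \<open>The height \<open>\<pi> x\<close> is the integer coordinate in
  \<open>x = \<phi> (\<pi> x) \<otimes> q x\<close>; its equivariance reduces the bounds to finitely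
  many representatives.\<close>

lemma finite_busemann_if_virtually_int:
  assumes "virtually_int G"
  shows "finite busemann"
proof -
  obtain H where H: "subgroup H G" "finite (rcosets H)" and iso: "G\<lparr>carrier := H\<rparr> \<cong> integer_group"
    using assms by (auto simp: virtually_int_def)
  have HG: "group (G\<lparr>carrier := H\<rparr>)" using subgroup.subgroup_is_group[OF H(1) is_group] .
  obtain \<phi> where "\<phi> \<in> iso integer_group (G\<lparr>carrier := H\<rparr>)"
    using group.iso_sym[OF HG iso] by (auto simp: is_iso_def)
  then have add: "\<And>m n. \<phi> (m + n) = \<phi> m \<otimes> \<phi> n" and bij: "bij_betw \<phi> UNIV H"
    by (auto simp: iso_def hom_def)
  have \<phi>H: "\<phi> n \<in> H" for n using bij by (auto simp: bij_betw_def)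
  have \<phi>: "\<phi> n \<in> carrier G" for n using \<phi>H[of n] subgroup.subset[OF H(1)] by blast
  obtain q where Q: "finite (q ` carrier G)" and qc: "\<And>x. x \<in> carrier G \<Longrightarrow> q x \<in> carrier G"
    and q: "\<And>x. x \<in> carrier G \<Longrightarrow> \<exists>h\<in>H. x = h \<otimes> q x"
    and q_inv: "\<And>h x. \<lbrakk>h \<in> H; x \<in> carrier G\<rbrakk> \<Longrightarrow> q (h \<otimes> x) = q x"
    using coset_representatives[OF H] by blast
  have "\<exists>n. x = \<phi> n \<otimes> q x" if x: "x \<in> carrier G" for x
    using q[OF x] bij by (auto simp: bij_betw_def)
  then obtain \<pi> where \<pi>: "\<And>x. x \<in> carrier G \<Longrightarrow> x = \<phi> (\<pi> x) \<otimes> q x" by metis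
  have \<pi>_shift: "\<pi> (\<phi> n \<otimes> x) = n + \<pi> x" if x: "x \<in> carrier G" for n x
  proof -
    have "q (\<phi> n \<otimes> x) = q x" using q_inv[OF \<phi>H x] .
    then have "\<phi> (\<pi> (\<phi> n \<otimes> x)) \<otimes> q x = \<phi> n \<otimes> (\<phi> (\<pi> x) \<otimes> q x)"
      using \<pi>[of "\<phi> n \<otimes> x"] \<pi>[OF x] \<phi>[of n] x by simp
    also have "\<dots> = \<phi> (n + \<pi> x) \<otimes> q x" using \<phi> qc[OF x] by (simp add: add m_assoc)
    finally have "\<phi> (\<pi> (\<phi> n \<otimes> x)) = \<phi> (n + \<pi> x)" using \<phi> qc[OF x] by simp
    then show ?thesis using bij by (auto simp: bij_betw_def dest: injD)
  qed
  \<comment> \<open>After a shift an edge starts at a representative \<open>r\<close>, so these are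
    all the height changes that can occur.\<close>
  define U where "U = insert 0 ((\<lambda>(r, c). \<bar>\<pi> (r \<otimes> c)\<bar>) ` (q ` carrier G \<times> {c \<in> carrier G. d \<one> c \<le> 1}))"
  define D where "D = Max U"
  have U: "finite U" unfolding U_def using Q finite_ball by auto
  have step: "\<bar>\<pi> y - \<pi> x\<bar> \<le> D" if x: "x \<in> carrier G" and y: "y \<in> carrier G" and xy: "d x y \<le> 1" for x y
  proof -
    define c where "c = inv x \<otimes> y"
    have c: "c \<in> carrier G" "y = x \<otimes> c" using x y by (auto simp: c_def m_assoc[symmetric])
    have "d \<one> c = d (x \<otimes> \<one>) (x \<otimes> c)" using d_left[OF x one_closed c(1)] by simp
    then have "d \<one> c \<le> 1" using xy c x by simp
    then have "\<bar>\<pi> (q x \<otimes> c)\<bar> \<in> U" using c(1) x by (force simp: U_def)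
    then have "\<bar>\<pi> (q x \<otimes> c)\<bar> \<le> D" unfolding D_def using Max_ge[OF U] by blast
    moreover have "y = \<phi> (\<pi> x) \<otimes> (q x \<otimes> c)"
      using c \<pi>[OF x] \<phi> qc[OF x] by (metis m_assoc)
    then have "\<pi> y = \<pi> x + \<pi> (q x \<otimes> c)" using \<pi>_shift[of "q x \<otimes> c" "\<pi> x"] qc[OF x] c(1) by simp
    ultimately show ?thesis by simp
  qed
  define B where "B = (\<lambda>(k, r). \<phi> k \<otimes> r) ` ({-D..D} \<times> q ` carrier G)"
  have B: "finite B" "B \<subseteq> carrier G" using Q \<phi> qc by (auto simp: B_def)
  have strip: "\<exists>z\<in>B. x = \<phi> n \<otimes> z" if x: "x \<in> carrier G" and n: "\<bar>\<pi> x - n\<bar> \<le> D" for x n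
  proof (rule bexI)
    have "x = \<phi> (n + (\<pi> x - n)) \<otimes> q x" using \<pi>[OF x] by simp
    then show "x = \<phi> n \<otimes> (\<phi> (\<pi> x - n) \<otimes> q x)"
      using \<phi> qc[OF x] by (metis add m_assoc)
    show "\<phi> (\<pi> x - n) \<otimes> q x \<in> B" using n x by (force simp: B_def)
  qed
  have plus: "finite (busemann_end \<pi>)"
  proof (rule finite_busemann_end[where \<phi> = \<phi> and B = B and D = D])
    show "\<pi> y \<le> \<pi> x + D" if "x \<in> carrier G" "y \<in> carrier G" "d x y \<le> 1" for x y
      using step[OF that] by simp
    show "\<exists>z\<in>B. x = \<phi> n \<otimes> z" if "x \<in> carrier G" "n \<le> \<pi> x" "\<pi> x \<le> n + D" for x n
      using strip[OF that(1), of n] that by simp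
  qed (use \<phi> B in auto)
  have minus: "finite (busemann_end (\<lambda>x. - \<pi> x))"
  proof (rule finite_busemann_end[where \<phi> = "\<lambda>n. \<phi> (- n)" and B = B and D = D])
    show "- \<pi> y \<le> - \<pi> x + D" if "x \<in> carrier G" "y \<in> carrier G" "d x y \<le> 1" for x y
      using step[OF that] by simp
    show "\<exists>z\<in>B. x = \<phi> (- n) \<otimes> z" if "x \<in> carrier G" "n \<le> - \<pi> x" "- \<pi> x \<le> n + D" for x n
      using strip[OF that(1), of "- n"] that by simp
  qed (use \<phi> B in auto)
  have "busemann \<subseteq> busemann_end \<pi> \<union> busemann_end (\<lambda>x. - \<pi> x)"
  proof
    fix f assume f: "f \<in> busemann"
    then obtain \<gamma> where \<gamma>: "geodesic \<gamma>" "limit_of \<gamma> f" by (auto simp: busemann_iff)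
    \<comment> \<open>A geodesic with heights bounded on both sides would stay in a finite set, yet
      it is injective.\<close>
    have "(\<forall>m. \<exists>i. m \<le> \<pi> (\<gamma> i)) \<or> (\<forall>m. \<exists>i. m \<le> - \<pi> (\<gamma> i))"
    proof (rule ccontr)
      assume "\<not> ?thesis"
      then obtain m m' where "\<forall>i. \<not> m \<le> \<pi> (\<gamma> i)" "\<forall>i. \<not> m' \<le> - \<pi> (\<gamma> i)" by blast
      then have m: "\<pi> (\<gamma> i) \<in> {- m'..m}" for i by (simp add: not_le) (metis less_imp_le minus_less_iff)
      have "range \<gamma> \<subseteq> (\<lambda>(k, r). \<phi> k \<otimes> r) ` ({- m'..m} \<times> q ` carrier G)"
      proof
        fix x assume "x \<in> range \<gamma>"
        then obtain i where i: "x = \<gamma> i" by blast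
        have "(\<pi> x, q x) \<in> {- m'..m} \<times> q ` carrier G" "x = \<phi> (\<pi> x) \<otimes> q x"
          using m[of i] geodesic_closed[OF \<gamma>(1)] \<pi> unfolding i by blast+
        then show "x \<in> (\<lambda>(k, r). \<phi> k \<otimes> r) ` ({- m'..m} \<times> q ` carrier G)"
          by (intro image_eqI[of _ _ "(\<pi> x, q x)"]) auto
      qed
      then have "finite (range \<gamma>)" using Q finite_subset by blast
      moreover have "inj \<gamma>"
      proof (rule injI)
        fix i j assume "\<gamma> i = \<gamma> j"
        moreover have "real (d (\<gamma> i) (\<gamma> j)) = \<bar>real i - real j\<bar>" using \<gamma>(1) by (simp add: infinite_geodesic_def)
        ultimately show "i = j" using geodesic_closed[OF \<gamma>(1)] by (simp add: d_self)
      qed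
      ultimately show False using finite_imageD infinite_UNIV_nat by blast
    qed
    then show "f \<in> busemann_end \<pi> \<union> busemann_end (\<lambda>x. - \<pi> x)"
      using f \<gamma> unfolding busemann_end_def by blast
  qed
  then show ?thesis using plus minus finite_subset by blast
qed

end

section \<open>Virtually abelian groups\<close>

text \<open>No nonzero power of \<open>x\<close> lies in \<open>A\<close>, so 0 on \<open>A\<close>
  and 1 at \<open>x\<close> are compatible; the result extends to the whole group.\<close>

lemma (in comm_group) real_hom_separating:
  assumes E: "finite E" "E \<subseteq> carrier G" "generate G E = carrier G"
    and A: "subgroup A G" and x: "x \<in> carrier G" and free: "\<And>n::nat. n > 0 \<Longrightarrow> x [^] n \<notin> A"
  shows "\<exists>h. real_hom G (carrier G) h \<and> (\<forall>a\<in>A. h a = 0) \<and> h x = 1"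
proof -
  have zero: "n = 0" if n: "x [^] n \<in> A" for n :: int
  proof (rule ccontr)
    assume "n \<noteq> 0"
    have "x [^] (- n) \<in> A" using subgroup.m_inv_closed[OF A n] x by (simp add: int_pow_neg)
    with n have "x [^] int (nat \<bar>n\<bar>) \<in> A" by (cases "n \<ge> 0") simp_all
    then have "x [^] nat \<bar>n\<bar> \<in> A" unfolding int_pow_int .
    then show False using free[of "nat \<bar>n\<bar>"] \<open>n \<noteq> 0\<close> by simp
  qed
  have "real_hom G A (\<lambda>_. 0)" by (simp add: real_hom_def)
  from real_hom_extend_adjoin[OF A x this, of 1] zero
  obtain f where f: "real_hom G (adjoin A x) f"
    "\<And>a (n::int). a \<in> A \<Longrightarrow> f (a \<otimes> x [^] n) = 0 + real_of_int n * 1"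
    by fastforce
  obtain h where h: "real_hom G (carrier G) h" "\<And>y. y \<in> adjoin A x \<Longrightarrow> h y = f y"
    using real_hom_extend[OF E adjoin_subgroup[OF A x] f(1)] by blast
  have "h a = 0" if a: "a \<in> A" for a
  proof -
    have "a \<in> carrier G" using a A subgroup.mem_carrier by fastforce
    then show ?thesis using h(2) adjoin_superset(1)[OF A x] a f(2)[OF a, of 0] by auto
  qed
  moreover have "h x = 1"
    using h(2)[OF adjoin_superset(2)[OF A x]] f(2)[OF subgroup.one_closed[OF A], of 1] x by simp
  ultimately show ?thesis using h(1) by blast
qed

lemma (in group) finite_rcosetsI:
  assumes H: "subgroup H G" and R: "finite R" "R \<subseteq> carrier G"
    and cover: "carrier G \<subseteq> (\<Union>r\<in>R. H #> r)"
  shows "finite (rcosets H)"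
proof (rule finite_subset)
  show "rcosets H \<subseteq> (\<lambda>r. H #> r) ` R"
  proof
    fix C assume "C \<in> rcosets H"
    then obtain x where x: "x \<in> carrier G" "C = H #> x" by (auto simp: RCOSETS_def)
    then obtain r where "r \<in> R" "x \<in> H #> r" using cover by blast
    then show "C \<in> (\<lambda>r. H #> r) ` R" using repr_independence[of x H r] H R x by blast
  qed
qed (use R in simp)

lemma (in group) inv_mult_cancel [simp]:
  assumes "x \<in> carrier G" "y \<in> carrier G"
  shows "inv x \<otimes> (x \<otimes> y) = y" "x \<otimes> (inv x \<otimes> y) = y"
  using assms by (simp_all add: m_assoc[symmetric])

lemma (in group) conjugate_nat_pow:
  assumes "p \<in> carrier G" "c \<in> carrier G"
  shows "(p \<otimes> c \<otimes> inv p) [^] (n::nat) = p \<otimes> c [^] n \<otimes> inv p"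
proof (induction n)
  case (Suc n)
  then show ?case using assms by (simp add: m_assoc)
qed (use assms in simp)

section \<open>Word length, periodic geodesics and periodic Busemann functions\<close>

context word_metric
begin

lemma len_mult: "\<lbrakk>x \<in> carrier G; y \<in> carrier G\<rbrakk> \<Longrightarrow> d \<one> (x \<otimes> y) \<le> d \<one> x + d \<one> y"
  using d_triangle[of \<one> x "x \<otimes> y"] d_left[of x \<one> y] by simp

lemma d_len: "\<lbrakk>x \<in> carrier G; y \<in> carrier G\<rbrakk> \<Longrightarrow> d x y = d \<one> (inv x \<otimes> y)"
  using d_left[of "inv x" x y] by simp

lemma len_inv: "x \<in> carrier G \<Longrightarrow> d \<one> (inv x) = d \<one> x"
  using d_left[of "inv x" \<one> x] d_sym[of "inv x" \<one>] by simp

lemma len_nat_pow: "x \<in> carrier G \<Longrightarrow> d \<one> (x [^] (n::nat)) \<le> n * d \<one> x"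
proof (induction n)
  case (Suc n)
  then show ?case using len_mult[of "x [^] n" x] by simp
qed (simp add: d_self)

text \<open>A deficit of at least 1 in the length of \<open>c [^] n\<close> is multiplied by
  \<open>Suc K\<close> in its power with exponent \<open>Suc K\<close>, which exceeds the permitted
  deficit \<open>K\<close>.\<close>

lemma len_nat_pow_eq:
  assumes c: "c \<in> carrier G" and ge: "\<And>n. n * d \<one> c \<le> K + d \<one> (c [^] n)"
  shows "d \<one> (c [^] n) = n * d \<one> c"
proof (rule antisym[OF len_nat_pow[OF c]], rule ccontr)
  assume "\<not> n * d \<one> c \<le> d \<one> (c [^] n)"
  then have lt: "d \<one> (c [^] n) + 1 \<le> n * d \<one> c" by simp
  have "n * Suc K * d \<one> c \<le> K + d \<one> ((c [^] n) [^] Suc K)"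
    using ge[of "n * Suc K"] c by (simp only: nat_pow_pow)
  also have "\<dots> \<le> K + Suc K * d \<one> (c [^] n)"
    using len_nat_pow[of "c [^] n" "Suc K"] c by simp
  also have "\<dots> < Suc K * (d \<one> (c [^] n) + 1)" by simp
  also have "\<dots> \<le> Suc K * (n * d \<one> c)" using lt by (rule mult_le_mono2)
  finally show False by (simp add: algebra_simps)
qed

lemma periodic_geodesic:
  assumes p: "p \<in> carrier G" and c: "c \<in> carrier G" "c \<noteq> \<one>"
    and eq: "\<And>n. d \<one> (c [^] n) = n * d \<one> c"
  shows "\<exists>\<gamma>. geodesic \<gamma> \<and> (\<forall>n. \<gamma> (n * d \<one> c) = p \<otimes> c [^] n)"
proof -
  define l where "l = d \<one> c"
  have l: "l > 0" using d_eq_0[OF one_closed c(1)] c(2) by (auto simp: l_def)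
  obtain w where w: "w 0 = \<one>" "w l = c" and wc: "\<And>i. w i \<in> carrier G"
    and ws: "\<And>i. d (w i) (w (Suc i)) \<le> 1"
    using geodesic_path[OF one_closed c(1)] unfolding l_def by blast
  \<comment> \<open>Translates of one geodesic from \<open>\<one>\<close> to \<open>c\<close> are
    strung together: \<open>i div l\<close> counts the completed copies and \<open>i mod l\<close>
    is the position in the current one.\<close>
  define \<gamma> where "\<gamma> i = p \<otimes> c [^] (i div l) \<otimes> w (i mod l)" for i
  have mult: "\<gamma> (n * l) = p \<otimes> c [^] n" for n using l w p c by (simp add: \<gamma>_def)
  have "geodesic \<gamma>"
  proof (rule geodesicI)
    fix i
    have "\<gamma> (Suc i) = p \<otimes> c [^] (i div l) \<otimes> w (Suc (i mod l))"
    proof (cases "Suc (i mod l) = l")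
      case True
      then have "Suc i div l = Suc (i div l)" "Suc i mod l = 0" by (simp_all add: div_Suc mod_Suc)
      then show ?thesis using True w p c by (simp add: \<gamma>_def m_assoc)
    next
      case False
      then show ?thesis by (simp add: \<gamma>_def div_Suc mod_Suc)
    qed
    then show "d (\<gamma> i) (\<gamma> (Suc i)) \<le> 1"
      using ws[of "i mod l"] wc p c by (simp add: \<gamma>_def d_left)
  next
    fix m
    have "d (\<gamma> 0) (\<gamma> (m * l)) = d \<one> (c [^] m)"
      using mult[of 0] mult[of m] d_left[OF p one_closed, of "c [^] m"] p c by simp
    then have "m * l \<le> d (\<gamma> 0) (\<gamma> (m * l))" using eq by (simp add: l_def)
    moreover have "m \<le> m * l" using l by simp
    ultimately show "\<exists>n\<ge>m. n \<le> d (\<gamma> 0) (\<gamma> n)" by blast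
  qed (use wc p c in \<open>simp add: \<gamma>_def\<close>)
  then show ?thesis using mult by (auto simp: l_def)
qed

text \<open>The translates of \<open>f\<close> by the powers of \<open>y\<close> are Busemann
  points, so two of them coincide; the difference of the exponents is the period.\<close>

lemma busemann_eventually_periodic:
  assumes fin: "finite busemann" and f: "f \<in> busemann" and y: "y \<in> carrier G"
  shows "\<exists>n::nat. n > 0 \<and> (\<exists>c. \<forall>z\<in>carrier G. f (y [^] n \<otimes> z) = f z + c)"
proof -
  define F where "F i = restrict (\<lambda>z. f (y [^] i \<otimes> z) - f (y [^] i)) (carrier G)" for i :: nat
  have "range F \<subseteq> busemann" using busemann_translate[OF f] y by (auto simp: F_def)
  then have "\<not> inj F" using fin finite_subset finite_imageD infinite_UNIV_nat by metis
  then obtain i j where ij: "i < j" "F i = F j" unfolding inj_def by (metis linorder_neqE_nat)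
  have "f (y [^] (j - i) \<otimes> z) = f z + (f (y [^] j) - f (y [^] i))" if z: "z \<in> carrier G" for z
  proof -
    have iz: "inv (y [^] i) \<otimes> z \<in> carrier G" using y z by simp
    have "y [^] j = y [^] (j - i) \<otimes> y [^] i" using y ij by (simp add: nat_pow_mult)
    then have "y [^] j \<otimes> (inv (y [^] i) \<otimes> z) = y [^] (j - i) \<otimes> z"
      using y z by (simp add: m_assoc)
    then show ?thesis using fun_cong[OF ij(2), of "inv (y [^] i) \<otimes> z"] y z iz by (simp add: F_def)
  qed
  then show ?thesis using ij by (intro exI[of _ "j - i"]) auto
qed

text \<open>Some power of \<open>y\<close> shifts \<open>f\<close> by a constant; comparing the growth of \<open>f\<close> and \<open>g\<close> along its positive
  and its negative powers then pins down \<open>g y\<close>.\<close>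

lemma busemann_determines_real_hom:
  assumes fin: "finite busemann" and f: "f \<in> busemann" and H: "subgroup H G" and y: "y \<in> H"
  shows "\<exists>q. \<forall>g K. real_hom G H g \<longrightarrow> (\<forall>x\<in>H. - f x - K \<le> g x) \<longrightarrow> g y = q"
proof -
  have yc: "y \<in> carrier G" using y H subgroup.mem_carrier by fastforce
  obtain n :: nat and c where n: "n > 0" and per: "\<And>z. z \<in> carrier G \<Longrightarrow> f (y [^] n \<otimes> z) = f z + c"
    using busemann_eventually_periodic[OF fin f yc] by blast
  define u where "u = y [^] n"
  have uH: "u [^] k \<in> H" for k :: nat
    using subgroup_int_pow_closed[OF H subgroup_int_pow_closed[OF H y, of "int n"], of "int k"]
    by (simp add: u_def int_pow_int)
  have uc: "u \<in> carrier G" using yc by (simp add: u_def)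
  have per': "f (u [^] k \<otimes> z) = f z + real k * c" if z: "z \<in> carrier G" for k :: nat and z
  proof (induction k)
    case (Suc k)
    have "u [^] Suc k = u \<otimes> u [^] k" using uc nat_pow_Suc2 by blast
    then have "f (u [^] Suc k \<otimes> z) = f (u [^] k \<otimes> z) + c"
      using per[of "u [^] k \<otimes> z"] uc z by (simp add: m_assoc u_def)
    then show ?case using Suc by (simp add: algebra_simps)
  qed (use z in simp)
  have pos: "f (u [^] k) = real k * c" for k :: nat
    using per'[OF one_closed, of k] uc busemann_one[OF f] by simp
  have neg: "f (inv (u [^] k)) = - real k * c" for k :: nat
    using per'[of "inv (u [^] k)" k] uc busemann_one[OF f] by simp
  have "g y = - c / real n" if g: "real_hom G H g" and K: "\<And>x. x \<in> H \<Longrightarrow> - f x - K \<le> g x" for g K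
  proof -
    have gu: "g (u [^] k) = real k * (real n * g y)" for k :: nat
      using real_hom_nat_pow[OF is_group H g uH[of 1], of k] real_hom_nat_pow[OF is_group H g y, of n] uc
      by (simp add: u_def)
    \<comment> \<open>By the Archimedean property the error \<open>K\<close> disappears; positive
      and negative powers of \<open>u\<close> give the two opposite inequalities.\<close>
    have arch: "a \<le> 0" if "\<And>k::nat. real k * a \<le> K" for a
      using ex_less_of_nat_mult[of a K] that by (meson not_le)
    have "real k * (- c - real n * g y) \<le> K" for k :: nat
      using K[OF uH[of k]] gu[of k] pos[of k] by (simp add: algebra_simps)
    then have "- c - real n * g y \<le> 0" by (rule arch)
    moreover have "real k * (c + real n * g y) \<le> K" for k :: nat
      using K[OF subgroup.m_inv_closed[OF H uH[of k]]] gu[of k] neg[of k]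
        real_hom_inv[OF is_group H g uH[of k]] by (simp add: algebra_simps)
    then have "c + real n * g y \<le> 0" by (rule arch)
    ultimately show ?thesis using n by (simp add: field_simps)
  qed
  then show ?thesis by blast
qed

section \<open>Loops in the graph of cosets of an abelian subgroup\<close>

context
  fixes H
  assumes H: "subgroup H G" and comm: "\<And>x y. \<lbrakk>x \<in> H; y \<in> H\<rbrakk> \<Longrightarrow> x \<otimes> y = y \<otimes> x"
    and fin: "finite (rcosets H)"
begin

lemma H_closed: "x \<in> H \<Longrightarrow> x \<in> carrier G"
  using H subgroup.mem_carrier by fastforce

text \<open>Membership of \<open>p \<otimes> c \<otimes> inv p\<close> in \<open>H\<close> says that
  \<open>c\<close>, read from the coset \<open>H #> p\<close>, leads back to it: a loop in the coset
  graph, no longer than the number of cosets.\<close>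

definition cycle :: "'a \<Rightarrow> 'a \<Rightarrow> bool" where
  "cycle p c \<longleftrightarrow> p \<in> carrier G \<and> c \<in> carrier G \<and> p \<otimes> c \<otimes> inv p \<in> H \<and> d \<one> c \<le> card (rcosets H)"

definition cycles :: "'a set" where
  "cycles = {p \<otimes> c \<otimes> inv p | p c. cycle p c}"

text \<open>Along a long geodesic from \<open>\<one>\<close> to \<open>k\<close> some coset of \<open>H\<close> is visited twice within the first
  \<open>card (rcosets H)\<close> steps; cutting out the loop in between and translating the rest back
  leaves a shorter path, ending at \<open>k'\<close>.\<close>

lemma cycle_excision:
  assumes k: "k \<in> H" and long: "card (rcosets H) \<le> d \<one> k"
  shows "\<exists>p c k'. cycle p c \<and> k' \<in> H \<and> k = (p \<otimes> c \<otimes> inv p) \<otimes> k' \<and>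
    d \<one> c + d \<one> k' \<le> d \<one> k \<and> d \<one> k' < d \<one> k"
proof -
  define N where "N = card (rcosets H)"
  note kc = H_closed[OF k]
  obtain w where w: "w 0 = \<one>" "w (d \<one> k) = k" and wc: "\<And>i. w i \<in> carrier G"
    and ws: "\<And>i. d (w i) (w (Suc i)) \<le> 1"
    using geodesic_path[OF one_closed kc] by blast
  have "(\<lambda>i. H #> w i) ` {..N} \<subseteq> rcosets H" using rcosetsI[OF subgroup.subset[OF H] wc] by blast
  then have "card ((\<lambda>i. H #> w i) ` {..N}) \<le> N" using card_mono[OF fin] by (simp add: N_def)
  then have "card ((\<lambda>i. H #> w i) ` {..N}) < card {..N}" by simp
  then have "\<not> inj_on (\<lambda>i. H #> w i) {..N}" by (rule pigeonhole)
  then obtain i j where ij: "i < j" "j \<le> N" "H #> w i = H #> w j"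
    unfolding inj_on_def by (metis atMost_iff linorder_neqE_nat)
  have "w j \<in> H #> w i" using rcos_self[OF wc H] ij(3) by simp
  then obtain v where v: "v \<in> H" "w j = v \<otimes> w i" by (auto simp: r_coset_def)
  note vc = H_closed[OF v(1)]
  define c where "c = inv (w i) \<otimes> w j"
  define k' where "k' = inv v \<otimes> k"
  have cc: "c \<in> carrier G" using wc by (simp add: c_def)
  have "w i \<otimes> c = w j" using wc by (simp add: c_def m_assoc[symmetric])
  then have eq: "w i \<otimes> c \<otimes> inv (w i) = v" using v vc wc by (simp add: m_assoc)
  have lc: "d \<one> c \<le> j - i"
    using path_dist_le[of w, OF wc ws, of i "j - i"] d_len[OF wc wc, of i j] ij(1) by (simp add: c_def)
  have k'H: "k' \<in> H" unfolding k'_def using subgroup.m_closed[OF H] subgroup.m_inv_closed[OF H] v k by blast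
  have "d (w i) k' = d (v \<otimes> w i) (v \<otimes> k')" using d_left[OF vc wc H_closed[OF k'H]] by simp
  also have "v \<otimes> k' = k" using vc kc by (simp add: k'_def m_assoc[symmetric])
  also have "d (v \<otimes> w i) k = d (w j) (w (d \<one> k))" using v w by simp
  also have "\<dots> \<le> d \<one> k - j"
    using path_dist_le[of w, OF wc ws, of j "d \<one> k - j"] ij(2) long by (simp add: N_def)
  finally have "d (w i) k' \<le> d \<one> k - j" .
  moreover have "d \<one> (w i) \<le> i" using path_dist_le[of w, OF wc ws, of 0 i] w by simp
  ultimately have lk: "d \<one> k' \<le> i + (d \<one> k - j)"
    using d_triangle[OF one_closed wc H_closed[OF k'H], of i] by simp
  have "cycle (w i) c" using wc cc eq v lc ij by (simp add: cycle_def N_def)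
  moreover have "k = (w i \<otimes> c \<otimes> inv (w i)) \<otimes> k'" unfolding eq k'_def using vc kc by (simp add: m_assoc[symmetric])
  moreover have "d \<one> c + d \<one> k' \<le> d \<one> k" "d \<one> k' < d \<one> k"
    using lc lk ij long by (simp_all add: N_def)
  ultimately show ?thesis using k'H by blast
qed

lemma cycle_short: "\<lbrakk>k \<in> H; d \<one> k \<le> card (rcosets H)\<rbrakk> \<Longrightarrow> cycle \<one> k"
  using H_closed by (simp add: cycle_def)

lemma cycles_subset: "cycles \<subseteq> H"
  by (auto simp: cycles_def cycle_def)

text \<open>Writing \<open>p = h \<otimes> r\<close> with \<open>r\<close> a representative,
  conjugation by \<open>h\<close> is trivial on the abelian \<open>H\<close>. So finitely many base
  points suffice, and the loops \<open>c\<close> lie in a finite ball.\<close>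

lemma finite_cycles: "finite cycles"
proof -
  obtain q where q: "finite (q ` carrier G)" "\<And>x. x \<in> carrier G \<Longrightarrow> q x \<in> carrier G"
    "\<And>x. x \<in> carrier G \<Longrightarrow> \<exists>h\<in>H. x = h \<otimes> q x"
    using coset_representatives[OF H fin] by metis
  define R where "R = q ` carrier G"
  have R: "finite R" "R \<subseteq> carrier G" "\<And>x. x \<in> carrier G \<Longrightarrow> \<exists>h\<in>H. \<exists>r\<in>R. x = h \<otimes> r"
    unfolding R_def using q by blast+
  let ?B = "{c \<in> carrier G. d \<one> c \<le> card (rcosets H)}"
  have "cycles \<subseteq> (\<lambda>(r, c). r \<otimes> c \<otimes> inv r) ` (R \<times> ?B)"
  proof
    fix v assume "v \<in> cycles"
    then obtain p c where v: "v = p \<otimes> c \<otimes> inv p" "cycle p c" by (auto simp: cycles_def)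
    then have pc: "p \<in> carrier G" "c \<in> ?B" "v \<in> H" by (auto simp: cycle_def)
    obtain h r where h: "h \<in> H" "r \<in> R" "p = h \<otimes> r" using R(3)[OF pc(1)] by blast
    have hc: "h \<in> carrier G" "r \<in> carrier G" "v \<in> carrier G" using h R(2) H_closed pc by blast+
    have "v \<otimes> h = h \<otimes> (r \<otimes> c \<otimes> inv r)"
      unfolding v(1) h(3) using hc pc by (simp add: inv_mult_group m_assoc)
    with comm[OF h(1) pc(3)] have "h \<otimes> v = h \<otimes> (r \<otimes> c \<otimes> inv r)" by (rule trans)
    then have "v = r \<otimes> c \<otimes> inv r" by (rule l_cancel) (use hc pc in auto)
    then have "v = (\<lambda>(r, c). r \<otimes> c \<otimes> inv r) (r, c)" by simp
    then show "v \<in> (\<lambda>(r, c). r \<otimes> c \<otimes> inv r) ` (R \<times> ?B)"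
      by (rule image_eqI) (intro SigmaI h(2) pc(2))
  qed
  then show ?thesis by (rule finite_subset) (intro finite_imageI finite_cartesian_product R(1) finite_ball)
qed

text \<open>Excision removes loops until the remaining element is shorter than the number of cosets;
  it is then a loop based at \<open>\<one>\<close>.\<close>

lemma generate_cycles: "generate G cycles = H"
proof
  show "generate G cycles \<subseteq> H" using generate_subgroup_incl[OF cycles_subset H] .
  have "k \<in> generate G cycles" if "k \<in> H" for k
    using that
  proof (induction "d \<one> k" arbitrary: k rule: less_induct)
    case less
    show ?case
    proof (cases "card (rcosets H) \<le> d \<one> k")
      case True
      then obtain p c k' where pc: "cycle p c" "k' \<in> H" "k = (p \<otimes> c \<otimes> inv p) \<otimes> k'" "d \<one> k' < d \<one> k"
        using cycle_excision[OF less.prems] by blast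
      have "p \<otimes> c \<otimes> inv p \<in> cycles" unfolding cycles_def using pc(1) by blast
      then show ?thesis unfolding pc(3) by (intro generate.eng generate.incl less.hyps pc)
    next
      case False
      then have "cycle \<one> k" using cycle_short less.prems by simp
      moreover have "k = \<one> \<otimes> k \<otimes> inv \<one>" using H_closed[OF less.prems] by simp
      ultimately have "k \<in> cycles" unfolding cycles_def by blast
      then show ?thesis by (rule generate.incl)
    qed
  qed
  then show "H \<subseteq> generate G cycles" by blast
qed

text \<open>The same induction with lengths tracked: excision charges only
  \<open>d \<one> c\<close>, not the length of the conjugate, so the bounds for loops add
  up.\<close>

lemma real_hom_le_len:
  assumes g: "real_hom G H g" and M: "\<And>p c. cycle p c \<Longrightarrow> g (p \<otimes> c \<otimes> inv p) \<le> M * real (d \<one> c)" "M \<ge> 0"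
    and k: "k \<in> H"
  shows "g k \<le> M * real (d \<one> k)"
  using k
proof (induction "d \<one> k" arbitrary: k rule: less_induct)
  case less
  show ?case
  proof (cases "card (rcosets H) \<le> d \<one> k")
    case True
    then obtain p c k' where pc: "cycle p c" "k' \<in> H" "k = (p \<otimes> c \<otimes> inv p) \<otimes> k'"
      "d \<one> c + d \<one> k' \<le> d \<one> k" "d \<one> k' < d \<one> k"
      using cycle_excision[OF less.prems] by blast
    have "g k = g (p \<otimes> c \<otimes> inv p) + g k'"
      using g pc(1-3) unfolding real_hom_def cycle_def by blast
    also have "\<dots> \<le> M * real (d \<one> c) + M * real (d \<one> k')"
      using M(1)[OF pc(1)] less.hyps[OF pc(5,2)] by simp
    also have "\<dots> = M * real (d \<one> c + d \<one> k')" by (simp add: algebra_simps)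
    also have "\<dots> \<le> M * real (d \<one> k)" using pc(4) M(2) by (intro mult_left_mono) auto
    finally show ?thesis .
  next
    case False
    then have "cycle \<one> k" using cycle_short less.prems by simp
    from M(1)[OF this] show ?thesis using H_closed[OF less.prems] by simp
  qed
qed

text \<open>The ratio of \<open>g\<close> to loop length takes finitely many values, so its maximum
  is attained. It is positive because \<open>g\<close> is positive at \<open>k\<close> or at
  \<open>inv k\<close>.\<close>

lemma real_hom_max_cycle:
  assumes g: "real_hom G H g" and k: "k \<in> H" "g k \<noteq> 0"
  shows "\<exists>M>0. \<exists>p c. cycle p c \<and> c \<noteq> \<one> \<and> g (p \<otimes> c \<otimes> inv p) = M * real (d \<one> c) \<and>
    (\<forall>x\<in>H. g x \<le> M * real (d \<one> x))"
proof -
  \<comment> \<open>For \<open>c = \<one>\<close> the quotient is \<open>0 / 0 = 0\<close>.\<close>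
  define V where "V = {g (p \<otimes> c \<otimes> inv p) / real (d \<one> c) | p c. cycle p c}"
  have "V \<subseteq> (\<lambda>(v, n). g v / real n) ` (cycles \<times> {..card (rcosets H)})"
  proof
    fix a assume "a \<in> V"
    then obtain p c where "cycle p c" "a = g (p \<otimes> c \<otimes> inv p) / real (d \<one> c)" by (auto simp: V_def)
    then show "a \<in> (\<lambda>(v, n). g v / real n) ` (cycles \<times> {..card (rcosets H)})"
      by (intro image_eqI[of _ _ "(p \<otimes> c \<otimes> inv p, d \<one> c)"]) (auto simp: cycles_def cycle_def)
  qed
  then have V: "finite V" using finite_cycles finite_subset by blast
  have one: "cycle \<one> \<one>" using cycle_short[OF subgroup.one_closed[OF H]] by (simp add: d_self)
  have "0 \<in> V" using one by (force simp: V_def d_self)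
  define M where "M = Max V"
  have "M \<ge> 0" unfolding M_def using Max_ge[OF V \<open>0 \<in> V\<close>] .
  have "M \<in> V" unfolding M_def using \<open>0 \<in> V\<close> by (intro Max_in[OF V]) blast
  have "g (p \<otimes> c \<otimes> inv p) \<le> M * real (d \<one> c)" if pc: "cycle p c" for p c
  proof (cases "d \<one> c = 0")
    case True
    then have "c = \<one>" using d_eq_0[OF one_closed, of c] pc by (simp add: cycle_def)
    then show ?thesis using real_hom_one[OF is_group H g] pc by (simp add: cycle_def d_self)
  next
    case False
    have "g (p \<otimes> c \<otimes> inv p) / real (d \<one> c) \<le> M" unfolding M_def using pc V by (intro Max_ge) (auto simp: V_def)
    then show ?thesis using False by (simp add: field_simps)
  qed
  then have bound: "g x \<le> M * real (d \<one> x)" if "x \<in> H" for x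
    using real_hom_le_len[OF g _ \<open>M \<ge> 0\<close> that] by blast
  have "M \<noteq> 0"
  proof
    assume "M = 0"
    then have "g k \<le> 0" "g (inv k) \<le> 0"
      using bound[OF k(1)] bound[OF subgroup.m_inv_closed[OF H k(1)]] by simp_all
    then show False using real_hom_inv[OF is_group H g k(1)] k(2) by simp
  qed
  obtain p c where pc: "cycle p c" "M = g (p \<otimes> c \<otimes> inv p) / real (d \<one> c)"
    using \<open>M \<in> V\<close> by (auto simp: V_def)
  then have "d \<one> c \<noteq> 0" using \<open>M \<noteq> 0\<close> by auto
  then have "c \<noteq> \<one>" "g (p \<otimes> c \<otimes> inv p) = M * real (d \<one> c)" using pc(2) by (auto simp: d_self)
  moreover have "M > 0" using \<open>M \<ge> 0\<close> \<open>M \<noteq> 0\<close> by simp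
  ultimately show ?thesis using pc(1) bound by blast
qed

text \<open>The Busemann function comes from the periodic geodesic that repeats a loop on which \<open>g\<close> grows
  fastest relative to length.\<close>

lemma busemann_below_real_hom:
  assumes g: "real_hom G H g" and k: "k \<in> H" "g k \<noteq> 0"
  shows "\<exists>M>0. \<exists>f\<in>busemann. \<exists>K. \<forall>y\<in>H. - f y - K \<le> g y / M"
proof -
  obtain M p c where M: "M > 0" and pc: "cycle p c" "c \<noteq> \<one>"
    and gv: "g (p \<otimes> c \<otimes> inv p) = M * real (d \<one> c)"
    and bound: "\<And>x. x \<in> H \<Longrightarrow> g x \<le> M * real (d \<one> x)"
    using real_hom_max_cycle[OF g k] by blast
  define v where "v = p \<otimes> c \<otimes> inv p"
  define l where "l = d \<one> c"
  have p: "p \<in> carrier G" and c: "c \<in> carrier G" and v: "v \<in> H" using pc by (auto simp: cycle_def v_def)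
  have vn: "v [^] n = p \<otimes> c [^] n \<otimes> inv p" for n :: nat
    unfolding v_def using conjugate_nat_pow[OF p c] .
  have vnH: "v [^] n \<in> H" for n :: nat
    using subgroup_int_pow_closed[OF H v, of "int n"] by (simp add: int_pow_int)
  have gvn: "g (v [^] n) = M * real (n * l)" for n :: nat
    using real_hom_nat_pow[OF is_group H g v, of n] gv by (simp add: v_def l_def)
  \<comment> \<open>The bound \<open>g x \<le> M * real (d \<one> x)\<close> forces
    \<open>v [^] n\<close> to have length at least \<open>n * l\<close>; conjugation by
    \<open>p\<close> changes lengths by at most \<open>2 * d \<one> p\<close>.\<close>
  have "n * l \<le> 2 * d \<one> p + d \<one> (c [^] n)" for n
  proof -
    have "M * real (n * l) \<le> M * real (d \<one> (v [^] n))" using bound[OF vnH[of n]] gvn by simp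
    then have "n * l \<le> d \<one> (v [^] n)" using M by (simp del: of_nat_mult)
    also have "\<dots> \<le> d \<one> p + d \<one> (c [^] n) + d \<one> p"
      unfolding vn using len_mult[of "p \<otimes> c [^] n" "inv p"] len_mult[of p "c [^] n"] len_inv[OF p] p c by simp
    finally show ?thesis by simp
  qed
  then have len: "d \<one> (c [^] n) = n * d \<one> c" for n
    using len_nat_pow_eq[OF c, of "2 * d \<one> p"] by (simp add: l_def)
  obtain \<gamma> where \<gamma>: "geodesic \<gamma>" "\<And>n. \<gamma> (n * l) = p \<otimes> c [^] n"
    using periodic_geodesic[OF p c pc(2) len] unfolding l_def by blast
  obtain f where f: "f \<in> busemann" "limit_of \<gamma> f" using limit_of_exists[OF \<gamma>(1)] by blast
  have "- f y - 2 * real (d \<one> p) \<le> g y / M" if y: "y \<in> H" for y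
  proof -
    note yc = H_closed[OF y]
    have "\<forall>\<^sub>F n in sequentially. real (d (\<gamma> n) y) - real (d (\<gamma> n) \<one>) = f y"
      using f(2) yc by (simp add: limit_of_def)
    then obtain n where n: "\<And>i. i \<ge> n \<Longrightarrow> real (d (\<gamma> i) y) - real (d (\<gamma> i) \<one>) = f y"
      unfolding eventually_sequentially by blast
    have "l > 0" using d_eq_0[OF one_closed c] pc(2) by (auto simp: l_def)
    then have fy: "real (d (p \<otimes> c [^] n) y) - real (d (p \<otimes> c [^] n) \<one>) = f y"
      using n[of "n * l"] \<gamma>(2) by simp
    \<comment> \<open>The vertex \<open>p \<otimes> c [^] n\<close> equals
      \<open>x \<otimes> p\<close>, within \<open>d \<one> p\<close> of \<open>x \<in> H\<close>, so
      the bound on \<open>g\<close> can be applied to \<open>inv y \<otimes> x\<close>.\<close>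
    define x where "x = v [^] n"
    have xH: "x \<in> H" and xc: "x \<in> carrier G" using vnH H_closed by (auto simp: x_def)
    have xp: "x \<otimes> p = p \<otimes> c [^] n" unfolding x_def vn using p c by (simp add: m_assoc)
    have iy: "inv y \<in> H" using subgroup.m_inv_closed[OF H y] .
    have "- g y + M * real (n * l) = g (inv y \<otimes> x)"
      using g iy xH real_hom_inv[OF is_group H g y] gvn unfolding real_hom_def x_def by auto
    also have "\<dots> \<le> M * real (d \<one> (inv y \<otimes> x))" using bound subgroup.m_closed[OF H iy xH] by blast
    also have "d \<one> (inv y \<otimes> x) = d y x" using d_len[OF yc xc] by simp
    finally have "M * real (n * l) - g y \<le> M * real (d y x)" by simp
    then have "real (n * l) - g y / M \<le> real (d y x)" using M by (simp add: field_simps)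
    moreover have "d y x \<le> d (p \<otimes> c [^] n) y + d \<one> p"
      using d_triangle[OF yc, of "x \<otimes> p" x] d_left[OF xc p one_closed] d_sym[of y "x \<otimes> p"] d_sym[OF p one_closed]
        xc p c yc xp by simp
    moreover have "d (p \<otimes> c [^] n) \<one> \<le> d \<one> p + n * l"
      using len_mult[OF p, of "c [^] n"] len d_sym[of "p \<otimes> c [^] n" \<one>] p c by (simp add: l_def)
    ultimately show ?thesis using fy by linarith
  qed
  then show ?thesis using M f(1) by blast
qed

text \<open>The homomorphisms \<open>g0 + s * g1\<close> are pairwise non-proportional. Two of them
  must share a Busemann function, which would make them proportional.\<close>

lemma no_independent_real_homs:
  assumes fin: "finite busemann" and g0: "real_hom G H g0" and g1: "real_hom G H g1"
    and t: "t \<in> H" "g0 t = 1" "g1 t = 0" and x: "x \<in> H" "g1 x = 1"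
  shows False
proof -
  define g where "g s y = g0 y + real s * g1 y" for s :: nat and y
  have g: "real_hom G H (g s)" for s
    using g0 g1 by (simp add: real_hom_def g_def algebra_simps)
  have "\<exists>M>0. \<exists>f\<in>busemann. \<exists>K. \<forall>y\<in>H. - f y - K \<le> g s y / M" for s
    by (rule busemann_below_real_hom[OF g t(1)]) (simp add: g_def t)
  then obtain M f K where M: "\<And>s. M s > 0" and f: "\<And>s. f s \<in> busemann"
    and K: "\<And>s y. y \<in> H \<Longrightarrow> - f s y - K s \<le> g s y / M s"
    by metis
  have "range f \<subseteq> busemann" using f by blast
  then have "\<not> inj f" using fin finite_subset finite_imageD infinite_UNIV_nat by metis
  then obtain s s' where s: "s \<noteq> s'" "f s = f s'" unfolding inj_def by blast
  have hom: "real_hom G H (\<lambda>y. g s y / M s)" for s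
    using g[of s] by (simp add: real_hom_def add_divide_distrib)
  have eq: "g s y / M s = g s' y / M s'" if y: "y \<in> H" for y
  proof -
    obtain q where q: "\<And>g K. real_hom G H g \<Longrightarrow> (\<forall>x\<in>H. - f s x - K \<le> g x) \<Longrightarrow> g y = q"
      using busemann_determines_real_hom[OF fin f H y] by blast
    have "\<forall>x\<in>H. - f s x - K s \<le> g s x / M s" "\<forall>x\<in>H. - f s x - K s' \<le> g s' x / M s'"
      using K[of _ s] K[of _ s'] s(2) by auto
    then show ?thesis using q[OF hom[of s]] q[OF hom[of s']] by simp
  qed
  \<comment> \<open>At \<open>t\<close> both numerators are 1, so the scales agree; at
    \<open>x\<close> the common term \<open>g0 x\<close> cancels and leaves
    \<open>s = s'\<close>.\<close>
  have "M s = M s'" using eq[OF t(1)] M[of s] M[of s'] by (simp add: g_def t)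
  then have "g s x = g s' x" using eq[OF x(1)] M[of s'] by simp
  then show False using s(1) x(2) by (simp add: g_def)
qed

end

end

section \<open>An infinite cyclic subgroup of finite index\<close>

lemma (in group) virtually_int_if_powers_cover:
  assumes t: "t \<in> carrier G" and free: "\<And>n::nat. n > 0 \<Longrightarrow> t [^] n \<noteq> \<one>"
    and R: "finite R" "R \<subseteq> carrier G"
    and cover: "carrier G \<subseteq> (\<Union>r\<in>R. range (\<lambda>n::int. t [^] n) #> r)"
  shows "virtually_int G"
proof -
  let ?T = "range (\<lambda>n::int. t [^] n)"
  have T: "subgroup ?T G" using subgroup_of_powers[OF t] .
  have "inj (\<lambda>n::int. t [^] n)"
  proof (rule injI)
    fix m n :: int assume eq: "t [^] m = t [^] n"
    have "t [^] int (nat \<bar>m - n\<bar>) = \<one>"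
      using eq t int_pow_diff[of t m n] int_pow_diff[of t n m] by (cases "m \<ge> n") simp_all
    then have "t [^] nat \<bar>m - n\<bar> = \<one>" unfolding int_pow_int .
    then show "m = n" using free[of "nat \<bar>m - n\<bar>"] by (cases "m = n") auto
  qed
  then have "(\<lambda>n::int. t [^] n) \<in> iso integer_group (G\<lparr>carrier := ?T\<rparr>)"
    using t by (auto simp: iso_def hom_def bij_betw_def int_pow_mult)
  then have "G\<lparr>carrier := ?T\<rparr> \<cong> integer_group"
    using group.iso_sym[OF group_integer_group] by (auto simp: is_iso_def)
  then show ?thesis
    unfolding virtually_int_def using T finite_rcosetsI[OF T R cover] by blast
qed

context word_metric
begin

lemma virtually_int_if_finite_busemann:
  assumes inf: "infinite (carrier G)" and virt: "virtually_abelian G" and fin: "finite busemann"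
  shows "virtually_int G"
proof -
  obtain H where H: "subgroup H G" "finite (rcosets H)" and ab: "comm_group (G\<lparr>carrier := H\<rparr>)"
    using virt by (auto simp: virtually_abelian_def)
  interpret A: comm_group "G\<lparr>carrier := H\<rparr>" by fact
  have comm: "x \<otimes> y = y \<otimes> x" if "x \<in> H" "y \<in> H" for x y using A.m_comm[of x y] that by simp
  let ?E = "cycles H"
  have E: "finite ?E" "?E \<subseteq> carrier (G\<lparr>carrier := H\<rparr>)"
    "generate (G\<lparr>carrier := H\<rparr>) ?E = carrier (G\<lparr>carrier := H\<rparr>)"
    using finite_cycles[OF H(1) comm H(2)] cycles_subset[OF H(1) comm H(2)]
      generate_cycles[OF H(1) comm H(2)] generate_consistent[OF _ H(1), of ?E] by auto
  have pow: "x [^]\<^bsub>G\<lparr>carrier := H\<rparr>\<^esub> (n::nat) = x [^] n" for x n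
    using nat_pow_consistent by simp
  have hom: "real_hom (G\<lparr>carrier := H\<rparr>) H h \<longleftrightarrow> real_hom G H h" for h
    by (simp add: real_hom_def)
  obtain q where q: "finite (q ` carrier G)" "\<And>x. x \<in> carrier G \<Longrightarrow> q x \<in> carrier G"
    "\<And>x. x \<in> carrier G \<Longrightarrow> \<exists>h\<in>H. x = h \<otimes> q x"
    using coset_representatives[OF H] by metis
  define R where "R = q ` carrier G"
  have R: "finite R" "R \<subseteq> carrier G" "\<And>x. x \<in> carrier G \<Longrightarrow> \<exists>h\<in>H. \<exists>r\<in>R. x = h \<otimes> r"
    unfolding R_def using q by blast+
  \<comment> \<open>If \<open>H\<close> is torsion modulo \<open>T\<close>, then \<open>T\<close>
    has finite index in \<open>H\<close>, and products with the representatives in \<open>R\<close>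
    cover all of \<open>G\<close>.\<close>
  have cover: "\<exists>F. finite F \<and> F \<subseteq> carrier G \<and> carrier G \<subseteq> (\<Union>q\<in>F. T #> q)"
    if T: "subgroup T (G\<lparr>carrier := H\<rparr>)" and tor: "\<And>x. x \<in> H \<Longrightarrow> \<exists>n::nat. n > 0 \<and> x [^] n \<in> T" for T
  proof -
    have "T \<subseteq> carrier G" using subgroup.subset[OF T] subgroup.subset[OF H(1)] by auto
    have "\<exists>n::nat. n > 0 \<and> x [^]\<^bsub>G\<lparr>carrier := H\<rparr>\<^esub> n \<in> T" if "x \<in> ?E" for x
      using tor[of x] that E(2) unfolding pow by auto
    from A.finite_cosets_of_torsion_quotient[OF E T this]
    obtain F where F: "finite F" "F \<subseteq> H" "H \<subseteq> (\<Union>q\<in>F. T #> q)"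
      by (auto simp: r_coset_def)
    have Fc: "F \<subseteq> carrier G" using F(2) subgroup.subset[OF H(1)] by blast
    have "carrier G \<subseteq> (\<Union>q\<in>(\<lambda>(q, r). q \<otimes> r) ` (F \<times> R). T #> q)"
    proof
      fix x assume "x \<in> carrier G"
      then obtain h r where h: "h \<in> H" "r \<in> R" "x = h \<otimes> r" using R(3) by blast
      then obtain q where q: "q \<in> F" "h \<in> T #> q" using F(3) by blast
      then obtain u where u: "u \<in> T" "h = u \<otimes> q" by (auto simp: r_coset_def)
      have "x = u \<otimes> (q \<otimes> r)" unfolding h(3) u(2) using \<open>T \<subseteq> carrier G\<close> u(1) q(1) Fc h(2) R(2) by (intro m_assoc) auto
      then have "x \<in> T #> (q \<otimes> r)" using u(1) by (auto simp: r_coset_def)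
      then show "x \<in> (\<Union>q\<in>(\<lambda>(q, r). q \<otimes> r) ` (F \<times> R). T #> q)" using q(1) h(2) by fastforce
    qed
    moreover have "(\<lambda>(q, r). q \<otimes> r) ` (F \<times> R) \<subseteq> carrier G" using Fc R(2) by auto
    moreover have "finite ((\<lambda>(q, r). q \<otimes> r) ` (F \<times> R))" using F(1) R(1) by simp
    ultimately show ?thesis by blast
  qed
  have triv: "subgroup {\<one>} (G\<lparr>carrier := H\<rparr>)" using A.triv_subgroup by simp
  \<comment> \<open>Otherwise \<open>H\<close> is a torsion group, and applying \<open>cover\<close>
    to the trivial subgroup would make \<open>G\<close> finite.\<close>
  have "\<exists>t\<in>H. \<forall>n::nat. n > 0 \<longrightarrow> t [^] n \<noteq> \<one>"
  proof (rule ccontr)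
    assume "\<not> ?thesis"
    then have tor: "\<exists>n::nat. n > 0 \<and> x [^] n \<in> {\<one>}" if "x \<in> H" for x using that by blast
    obtain F where "finite F" "carrier G \<subseteq> (\<Union>q\<in>F. {\<one>} #> q)" using cover[OF triv tor] by blast
    moreover have "finite ({\<one>} #> q)" for q by (simp add: r_coset_def)
    ultimately show False using inf finite_subset by blast
  qed
  then obtain t where t: "t \<in> H" and free: "\<And>n::nat. n > 0 \<Longrightarrow> t [^] n \<noteq> \<one>" by blast
  have tc: "t \<in> carrier G" using t subgroup.subset[OF H(1)] by blast
  define T where "T = range (\<lambda>n::int. t [^] n)"
  have T: "subgroup T (G\<lparr>carrier := H\<rparr>)"
    using A.subgroup_of_powers[of t] t int_pow_consistent[OF H(1) t] by (simp add: T_def)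
  have tT: "t \<in> T" unfolding T_def by (rule range_eqI[of _ _ 1]) (simp add: tc)
  \<comment> \<open>An \<open>x\<close> of infinite order modulo \<open>T\<close> would give
    \<open>g1\<close> vanishing at \<open>t\<close> but not at \<open>x\<close>, alongside
    \<open>g0\<close> with \<open>g0 t = 1\<close>: an independent pair.\<close>
  have "\<exists>n::nat. n > 0 \<and> x [^] n \<in> T" if x: "x \<in> H" for x
  proof (rule ccontr)
    assume "\<not> ?thesis"
    then have "x [^]\<^bsub>G\<lparr>carrier := H\<rparr>\<^esub> n \<notin> T" if "n > 0" for n :: nat
      unfolding pow using that by blast
    from A.real_hom_separating[OF E T _ this]
    obtain g1 where g1: "real_hom G H g1" "\<And>a. a \<in> T \<Longrightarrow> g1 a = 0" "g1 x = 1"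
      using x hom by auto
    have "t [^]\<^bsub>G\<lparr>carrier := H\<rparr>\<^esub> n \<notin> {\<one>}" if "n > 0" for n :: nat
      unfolding pow using free[OF that] by simp
    from A.real_hom_separating[OF E triv _ this]
    obtain g0 where g0: "real_hom G H g0" "g0 t = 1"
      using t hom by auto
    show False
      using no_independent_real_homs[OF H(1) comm H(2) fin g0(1) g1(1) t g0(2) g1(2)[OF tT] x g1(3)] .
  qed
  from cover[OF T this] show ?thesis
    using virtually_int_if_powers_cover[OF tc free] unfolding T_def by blast
qed

end

theorem theorem1p2:
  fixes G :: "('a, 'b) monoid_scheme" and S :: "'a set"
  assumes "group G"
    and "infinite (carrier G)"
    and "virtually_abelian G"
    and "finite_symmetric_generating_set G S"
  shows "finite (busemann_points G (cayley_dist G S)) \<longleftrightarrow> virtually_int G"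
proof -
  interpret cayley G S using assms by (simp add: cayley_def cayley_axioms_def)
  show ?thesis
    unfolding cayley_dist_eq
    using finite_busemann_if_virtually_int virtually_int_if_finite_busemann assms(2,3) by blast
qed

end
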